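(* Let $H$ be a separable Hilbert space and fix $n>0$. Let $(X_1,\dots,X_n)$ be $H$-valued and $(\epsilon_1,\dots,\epsilon_n)$ real-valued random variables, and $(\mathcal{F}_t)_{t\geq 0}$ a filtration such that for all $t$: $X_t$ is $\mathcal{F}_{t-1}$-measurable, $\epsilon_t$ is $\mathcal{F}_t$-measurable, and $\mathbb{E}[\epsilon_t\mid\mathcal{F}_{t-1}]=0$. Suppose that there exist a constant $B$ and $\mathcal{F}_{i-1}$-measurable $\sigma_i$ with $\mathbb{E}[|\epsilon_i|^m\mid\mathcal{F}_{i-1}]\le \frac12 m!\,B^{m-2}\sigma_i^2$ for all $m\ge 2$ and all $i$. Fix $\rho>0$ and set $V_t=\sum_{i\leq t}X_iX_i^T$, $M_t=\sum_{i\le t}X_i\epsilon_i$, $G_t=(\rho I+V_t)^{-1/2}X_t$. If $\sum_{i\le n}\sigma_i^2\|G_i\|^2\le C_n^2$ almost surely for a deterministic $C_n\ge0$, then for $\delta\in(0,1)$, with probability at least $1-\delta$, $$\sup_{t\le n}\|(\rho I+V_t)^{-1/2}M_t\|\le B\log(2/\delta)+C_n\sqrt{2\log(2/\delta)}.$$ Equivalently, for all $r\ge0$, $$\mathbb{P}\Big(\sup_{t\le n}\|(\rho I+V_t)^{-1/2}M_t\|\ge r\Big)\le 2\exp\Big(-\frac{r^2}{2(C_n^2+Br)}\Big).$$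
   Context: For $f,g\in H$, $fg^T$ denotes the operator $f\langle g,\cdot\rangle$ on $H$, and $I$ is the identity operator on $H$. *)

theory Defs
  imports "HOL-Probability.Probability"
begin

definition rank1_op :: "'h::real_inner \<Rightarrow> 'h \<Rightarrow> 'h \<Rightarrow> 'h" where
  "rank1_op f g = (\<lambda>x. (g \<bullet> x) *\<^sub>R f)"

definition inv_sqrt_op :: "('h::real_inner \<Rightarrow> 'h) \<Rightarrow> ('h \<Rightarrow> 'h)" where
  "inv_sqrt_op A = (THE S. bounded_linear S \<and> (\<forall>x y. S x \<bullet> y = x \<bullet> S y)
      \<and> (\<forall>x. 0 \<le> S x \<bullet> x) \<and> (\<forall>x. S (S (A x)) = x) \<and> (\<forall>x. A (S (S x)) = x))"

definition gram_op :: "(nat \<Rightarrow> 'w \<Rightarrow> 'h::real_inner) \<Rightarrow> nat \<Rightarrow> 'w \<Rightarrow> 'h \<Rightarrow> 'h" where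
  "gram_op X t w = (\<lambda>x. \<Sum>i\<in>{1..t}. rank1_op (X i w) (X i w) x)"

definition reg_gram_op :: "real \<Rightarrow> (nat \<Rightarrow> 'w \<Rightarrow> 'h::real_inner) \<Rightarrow> nat \<Rightarrow> 'w \<Rightarrow> 'h \<Rightarrow> 'h" where
  "reg_gram_op \<rho> X t w = (\<lambda>x. \<rho> *\<^sub>R x + gram_op X t w x)"

definition mart_sum :: "(nat \<Rightarrow> 'w \<Rightarrow> 'h::real_vector) \<Rightarrow> (nat \<Rightarrow> 'w \<Rightarrow> real) \<Rightarrow> nat \<Rightarrow> 'w \<Rightarrow> 'h" where
  "mart_sum X \<epsilon> t w = (\<Sum>i\<in>{1..t}. \<epsilon> i w *\<^sub>R X i w)"

end

theory Submission
  imports Defs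
begin

text \<open>
  Write \<open>A\<^sub>t = \<rho> I + V\<^sub>t\<close>, \<open>N\<^sub>t = norm (A\<^sub>t\<^bsup>-1/2\<^esup> M\<^sub>t)\<close> and \<open>Q\<^sub>t = (\<Sum>i\<le>t. \<sigma>\<^sub>i\<^sup>2 (norm G\<^sub>i)\<^sup>2)\<close>. For \<open>\<lambda> B < 1\<close> and
  \<open>\<kappa> = \<lambda>\<^sup>2 / (2 (1 - \<lambda> B))\<close> the process \<open>cosh (\<lambda> N\<^sub>t) exp (- \<kappa> Q\<^sub>t)\<close> is a supermartingale: \<open>A\<^sub>t\<close> is
  predictable and \<open>A\<^sub>t \<ge> A\<^sub>t\<^sub>-\<^sub>1\<close>, so \<open>norm (A\<^sub>t\<^bsup>-1/2\<^esup> M\<^sub>t\<^sub>-\<^sub>1) \<le> N\<^sub>t\<^sub>-\<^sub>1\<close>; Pinelis' inequality for \<open>cosh (norm (x + u))\<close>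
  has a term linear in \<open>u = \<epsilon>\<^sub>t G\<^sub>t\<close>, which vanishes in conditional mean, and a remainder that the
  Bernstein moment condition sums to a geometric series, using \<open>norm G\<^sub>t \<le> 1\<close>. The maximal inequality
  gives \<open>P (max N\<^sub>t \<ge> r) \<le> 2 exp (- \<lambda> r + \<kappa> C\<^sup>2)\<close>, and both bounds follow by choosing \<open>\<lambda>\<close>. The bound in
  terms of \<open>\<delta>\<close> is the sharper one: it does not follow from the bound in terms of \<open>r\<close>.
\<close>

subsection \<open>Positive square roots of operators\<close>

text \<open>The inverse square root of \<open>A\<close> is the positive square root of its inverse.
  With that inverse passed as \<open>R\<close>, the construction of the root involves no
  inversion.\<close>

definition pos_sqrt :: "('h::real_inner \<Rightarrow> 'h) \<Rightarrow> ('h \<Rightarrow> 'h) \<Rightarrow> bool" where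
  "pos_sqrt R S \<longleftrightarrow> bounded_linear S \<and> (\<forall>x y. S x \<bullet> y = x \<bullet> S y) \<and> (\<forall>x. 0 \<le> S x \<bullet> x)
     \<and> (\<forall>x. S (S x) = R x)"

text \<open>If \<open>Y\<close> solves \<open>Y = (K + Y\<^sup>2) / 2\<close>, then \<open>(1 - Y)\<^sup>2 = 1 - K\<close>. The iteration converges geometrically
  when \<open>norm K < 1\<close>. Limits are taken pointwise, since the sort \<open>{real_inner, complete_space}\<close> is not
  below \<open>banach\<close>, which the operator-norm library requires.\<close>

fun sqrt_iter :: "('h::real_inner \<Rightarrow> 'h) \<Rightarrow> nat \<Rightarrow> 'h \<Rightarrow> 'h" where
  "sqrt_iter K 0 x = 0"
| "sqrt_iter K (Suc n) x = (1/2) *\<^sub>R (K x + sqrt_iter K n (sqrt_iter K n x))"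

lemma linear_sqrt_iter:
  assumes "linear K"
  shows "linear (sqrt_iter K n)"
proof (induction n)
  case 0
  show ?case by (simp add: linear_iff)
next
  case (Suc n)
  then show ?case using assms by (simp add: linear_iff algebra_simps)
qed

lemma sqrt_iter_symmetric:
  assumes "\<And>x y. K x \<bullet> y = x \<bullet> K y"
  shows "sqrt_iter K n x \<bullet> y = x \<bullet> sqrt_iter K n y"
  by (induction n arbitrary: x y) (simp_all add: assms inner_add_left inner_add_right)

text \<open>The iterates are polynomials in \<open>K\<close>. In the limit the root commutes with
  every bounded operator that commutes with \<open>K\<close>, on which uniqueness rests.\<close>

lemma sqrt_iter_commute:
  assumes "linear T" "\<And>x. T (K x) = K (T x)"
  shows "T (sqrt_iter K n x) = sqrt_iter K n (T x)"
  by (induction n arbitrary: x) (simp_all add: assms linear_0 linear_add linear_scale)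

text \<open>\<open>1 - sqrt (1 - q)\<close> is the smaller fixed point of the scalar recursion
  \<open>y = (q + y * y) / 2\<close>, and an iteration started at 0 stays below it.\<close>

lemma norm_sqrt_iter_le:
  assumes K: "\<And>x. norm (K x) \<le> q * norm x" and q: "q \<le> 1" "0 \<le> q"
  shows "norm (sqrt_iter K n x) \<le> (1 - sqrt (1 - q)) * norm x"
proof (induction n arbitrary: x)
  case 0
  show ?case using q by simp
next
  case (Suc n)
  define y where "y = 1 - sqrt (1 - q)"
  have y: "0 \<le> y" using q by (simp add: y_def)
  have yy: "q + y * y = 2 * y"
    using q by (simp add: y_def algebra_simps)
  have "norm (sqrt_iter K n (sqrt_iter K n x)) \<le> y * (y * norm x)"
    using Suc[of "sqrt_iter K n x"] mult_left_mono[OF Suc[of x], of y] y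
    unfolding y_def[symmetric] by linarith
  then have "norm (K x + sqrt_iter K n (sqrt_iter K n x)) \<le> (q + y * y) * norm x"
    using K[of x] norm_triangle_ineq[of "K x" "sqrt_iter K n (sqrt_iter K n x)"]
    by (simp add: algebra_simps)
  then show ?case unfolding yy y_def[symmetric] by simp
qed

text \<open>The new increment is half of \<open>a (a x - b x) + (a (b x) - b (b x))\<close>. Each
  summand gains one factor \<open>1 - sqrt (1 - q)\<close>, and the factor \<open>1/2\<close>
  absorbs their number.\<close>

lemma norm_sqrt_iter_diff_le:
  assumes lin: "linear K" and K: "\<And>x. norm (K x) \<le> q * norm x" and q: "q \<le> 1" "0 \<le> q"
  shows "norm (sqrt_iter K (Suc n) x - sqrt_iter K n x) \<le> (1 - sqrt (1 - q)) ^ n * norm x"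
proof (induction n arbitrary: x)
  case 0
  have "q * norm x \<le> 1 * norm x" using q by (intro mult_right_mono) auto
  then show ?case using order_trans[OF K[of x], of "norm x"] order_trans[of "norm (K x)" "norm x" "norm x * 2"] by simp
next
  case (Suc n)
  define y where "y = 1 - sqrt (1 - q)"
  have y: "0 \<le> y" using q by (simp add: y_def)
  define a where "a = sqrt_iter K (Suc n)"
  define b where "b = sqrt_iter K n"
  have la: "linear a" unfolding a_def by (rule linear_sqrt_iter[OF lin])
  have "sqrt_iter K (Suc (Suc n)) x - sqrt_iter K (Suc n) x = (1/2) *\<^sub>R (a (a x) - b (b x))"
    by (simp add: a_def b_def algebra_simps)
  also have "a (a x) - b (b x) = a (a x - b x) + (a (b x) - b (b x))"
    by (simp add: linear_diff[OF la])
  finally have eq: "norm (sqrt_iter K (Suc (Suc n)) x - sqrt_iter K (Suc n) x)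
      \<le> (1/2) * (norm (a (a x - b x)) + norm (a (b x) - b (b x)))"
    using norm_triangle_ineq[of "a (a x - b x)" "a (b x) - b (b x)"] by simp
  have 1: "norm (a (a x - b x)) \<le> y * (y ^ n * norm x)"
  proof -
    have "norm (a (a x - b x)) \<le> y * norm (a x - b x)"
      unfolding a_def y_def by (rule norm_sqrt_iter_le[OF K q])
    also have "\<dots> \<le> y * (y ^ n * norm x)"
      using Suc y unfolding a_def b_def y_def by (intro mult_left_mono) auto
    finally show ?thesis .
  qed
  have 2: "norm (a (b x) - b (b x)) \<le> y ^ n * (y * norm x)"
  proof -
    have "norm (a (b x) - b (b x)) \<le> y ^ n * norm (b x)"
      using Suc unfolding a_def b_def y_def by blast
    also have "\<dots> \<le> y ^ n * (y * norm x)"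
      unfolding b_def y_def[symmetric]
      using norm_sqrt_iter_le[OF K q, of n x] y by (intro mult_left_mono) (auto simp: y_def)
    finally show ?thesis .
  qed
  show ?case using eq 1 2 unfolding y_def[symmetric] by (simp add: algebra_simps)
qed

lemma geometric_increments_Cauchy:
  fixes f :: "nat \<Rightarrow> 'a::real_normed_vector"
  assumes y: "0 \<le> y" "y < 1" and f: "\<And>n. norm (f (Suc n) - f n) \<le> y ^ n * c"
  shows "Cauchy f"
proof -
  have c: "c \<ge> 0" using f[of 0] norm_ge_zero[of "f 1 - f 0"] by (simp del: norm_ge_zero)
  have b: "norm (f (m + k) - f m) \<le> y ^ m * c * (1 - y ^ k) / (1 - y)" for m k
  proof (induction k)
    case 0
    show ?case by simp
  next
    case (Suc k)
    have "norm (f (m + Suc k) - f m) \<le> norm (f (Suc (m + k)) - f (m + k)) + norm (f (m + k) - f m)"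
      using norm_triangle_ineq[of "f (Suc (m + k)) - f (m + k)" "f (m + k) - f m"] by simp
    also have "\<dots> \<le> y ^ (m + k) * c + y ^ m * c * (1 - y ^ k) / (1 - y)"
      using f Suc by (intro add_mono) auto
    also have "\<dots> = y ^ m * c * (1 - y ^ Suc k) / (1 - y)"
      using y by (simp add: field_simps power_add)
    finally show ?case .
  qed
  have b': "norm (f (m + k) - f m) \<le> y ^ m * c / (1 - y)" for m k
  proof -
    have "y ^ m * c * (1 - y ^ k) \<le> y ^ m * c * 1"
      using y c by (intro mult_left_mono) auto
    then show ?thesis using b[of m k] y by (smt (verit) divide_right_mono mult.right_neutral)
  qed
  have lim: "(\<lambda>m. y ^ m * c / (1 - y)) \<longlonglongrightarrow> 0"
    using y by (auto intro!: tendsto_eq_intros LIMSEQ_power_zero)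
  show ?thesis
  proof (rule CauchyI')
    fix e :: real assume "0 < e"
    then have "\<forall>\<^sub>F m in sequentially. y ^ m * c / (1 - y) < e"
      using lim order_tendstoD(2) by blast
    then obtain N where N: "\<And>m. m \<ge> N \<Longrightarrow> y ^ m * c / (1 - y) < e"
      unfolding eventually_sequentially by blast
    have "dist (f m) (f k) < e" if "N \<le> m" "m < k" for m k
      using b'[of m "k - m"] N[of m] that by (simp add: dist_norm norm_minus_commute)
    then show "\<exists>N. \<forall>m\<ge>N. \<forall>k>m. dist (f m) (f k) < e" by blast
  qed
qed

lemma pos_sqrt_one_minus_exists:
  fixes K :: "'h::{real_inner, complete_space} \<Rightarrow> 'h"
  assumes lin: "linear K" and sym: "\<And>x y. K x \<bullet> y = x \<bullet> K y"
    and K: "\<And>x. norm (K x) \<le> q * norm x" and q: "0 \<le> q" "q < 1"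
  obtains S where "pos_sqrt (\<lambda>x. x - K x) S"
    "\<And>T x. bounded_linear T \<Longrightarrow> (\<And>x. T (K x) = K (T x)) \<Longrightarrow> T (S x) = S (T x)"
proof -
  define y where "y = 1 - sqrt (1 - q)"
  have y: "0 \<le> y" "y < 1" using q by (auto simp: y_def)
  have q': "q \<le> 1" using q by simp
  let ?Y = "sqrt_iter K"
  have "convergent (\<lambda>n. ?Y n x)" for x
    using geometric_increments_Cauchy[OF y norm_sqrt_iter_diff_le[OF lin K q' q(1), folded y_def]]
    by (rule Cauchy_convergent)
  then obtain Y where Y: "\<And>x. (\<lambda>n. ?Y n x) \<longlonglongrightarrow> Y x"
    unfolding convergent_def by metis
  have Yadd: "Y (a + b) = Y a + Y b" for a b
    using linear_add[OF linear_sqrt_iter[OF lin]] tendsto_add[OF Y[of a] Y[of b]] Y[of "a + b"]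
    by (metis (no_types, lifting) LIMSEQ_unique ext)
  have Yscale: "Y (c *\<^sub>R a) = c *\<^sub>R Y a" for a c
    using linear_scale[OF linear_sqrt_iter[OF lin]] tendsto_scaleR[OF tendsto_const Y[of a], of c] Y[of "c *\<^sub>R a"]
    by (metis (no_types, lifting) LIMSEQ_unique ext)
  have Ybound: "norm (Y x) \<le> y * norm x" for x
    using norm_sqrt_iter_le[OF K q' q(1)] unfolding y_def
    by (intro LIMSEQ_le_const2[OF tendsto_norm[OF Y[of x]]]) auto
  have Ybl: "bounded_linear Y"
    using Yadd Yscale Ybound by (intro bounded_linear_intro[where K = y]) (auto simp: mult.commute)
  have Ysym: "Y a \<bullet> b = a \<bullet> Y b" for a b
    using tendsto_inner[OF Y[of a] tendsto_const[of b]] tendsto_inner[OF tendsto_const[of a] Y[of b]]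
      sqrt_iter_symmetric[of K, OF sym]
    by (simp add: LIMSEQ_unique)
  \<comment> \<open>In \<open>?Y n (?Y n x)\<close> operator and argument both vary; the norm bound
    uniform in \<open>n\<close> lets the argument be replaced by its limit first.\<close>
  have YY: "2 *\<^sub>R Y x = K x + Y (Y x)" for x
  proof -
    have d: "norm (?Y n (?Y n x) - ?Y n (Y x)) \<le> y * norm (?Y n x - Y x)" for n
      using norm_sqrt_iter_le[OF K q' q(1), of n "?Y n x - Y x"]
        linear_diff[OF linear_sqrt_iter[OF lin], of n] unfolding y_def by simp
    have z: "(\<lambda>n. y * norm (?Y n x - Y x)) \<longlonglongrightarrow> 0"
      using tendsto_mult[OF tendsto_const tendsto_norm[OF tendsto_diff[OF Y[of x] tendsto_const[of "Y x"]]], of y]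
      by simp
    have "(\<lambda>n. ?Y n (?Y n x) - ?Y n (Y x)) \<longlonglongrightarrow> 0"
      by (rule Lim_null_comparison[OF _ z]) (use d in auto)
    from tendsto_add[OF this Y[of "Y x"]]
    have "(\<lambda>n. ?Y n (?Y n x)) \<longlonglongrightarrow> Y (Y x)" by simp
    from tendsto_scaleR[OF tendsto_const tendsto_add[OF tendsto_const this], of "1/2" "K x"]
    have "(\<lambda>n. ?Y (Suc n) x) \<longlonglongrightarrow> (1/2) *\<^sub>R (K x + Y (Y x))" by simp
    moreover have "(\<lambda>n. ?Y (Suc n) x) \<longlonglongrightarrow> Y x" using Y[of x] by (rule LIMSEQ_Suc)
    ultimately have "Y x = (1/2) *\<^sub>R (K x + Y (Y x))" by (metis LIMSEQ_unique)
    then have "2 *\<^sub>R Y x = 2 *\<^sub>R (1/2) *\<^sub>R (K x + Y (Y x))" by (rule arg_cong)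
    then show ?thesis by simp
  qed
  show ?thesis
  proof (rule that[of "\<lambda>x. x - Y x"])
    have "0 \<le> (x - Y x) \<bullet> x" for x
    proof -
      have "Y x \<bullet> x \<le> norm (Y x) * norm x" by (rule norm_cauchy_schwarz)
      also have "\<dots> \<le> (y * norm x) * norm x" using Ybound by (intro mult_right_mono) auto
      also have "\<dots> \<le> (1 * norm x) * norm x" using y by (intro mult_right_mono) auto
      finally show ?thesis
        by (simp add: inner_diff_left power2_norm_eq_inner[symmetric] power2_eq_square)
    qed
    moreover have "x - Y x - Y (x - Y x) = x - K x" for x
      using YY[of x] unfolding linear_diff[OF bounded_linear.linear[OF Ybl]]
      by (simp add: algebra_simps scaleR_2)
    ultimately show "pos_sqrt (\<lambda>x. x - K x) (\<lambda>x. x - Y x)"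
      unfolding pos_sqrt_def using Ysym
      by (auto intro: bounded_linear_sub bounded_linear_ident Ybl simp: inner_diff_left inner_diff_right)
  next
    fix T x assume T: "bounded_linear T" and TK: "\<And>x. T (K x) = K (T x)"
    have "(\<lambda>n. T (?Y n x)) \<longlonglongrightarrow> T (Y x)"
      by (rule bounded_linear.tendsto[OF T Y])
    then have "(\<lambda>n. ?Y n (T x)) \<longlonglongrightarrow> T (Y x)"
      using sqrt_iter_commute[of T K, OF bounded_linear.linear[OF T] TK] by simp
    then have "T (Y x) = Y (T x)" using Y[of "T x"] LIMSEQ_unique by blast
    then show "T (x - Y x) = T x - Y (T x)"
      by (simp add: linear_diff[OF bounded_linear.linear[OF T]])
  qed
qed

text \<open>A zero of a non-negative quadratic form is a minimum, so the form cannot decrease in the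
  direction \<open>- S x\<close>. Along it the form is \<open>t * t * b - 2 * t * a\<close>,
  negative for small positive \<open>t\<close> unless \<open>a = 0\<close>.\<close>

lemma positive_symmetric_zero:
  fixes S :: "'h::real_inner \<Rightarrow> 'h"
  assumes lin: "linear S" and sym: "\<And>x y. S x \<bullet> y = x \<bullet> S y" and pos: "\<And>x. 0 \<le> S x \<bullet> x"
    and z: "S x \<bullet> x = 0"
  shows "S x = 0"
proof (rule ccontr)
  assume nz: "S x \<noteq> 0"
  define a where "a = S x \<bullet> S x"
  define b where "b = S (S x) \<bullet> S x"
  have a: "a > 0" using nz by (simp add: a_def)
  have b: "b \<ge> 0" using pos by (simp add: b_def)
  have "0 \<le> S (x - t *\<^sub>R S x) \<bullet> (x - t *\<^sub>R S x)" for t by (rule pos)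
  also have "S (x - t *\<^sub>R S x) \<bullet> (x - t *\<^sub>R S x) = t * t * b - 2 * t * a" for t
    using z sym[of "S x" x]
    by (simp add: linear_diff[OF lin] linear_scale[OF lin] inner_diff_left inner_diff_right a_def b_def
        algebra_simps)
  finally have t: "0 \<le> t * t * b - 2 * t * a" for t .
  \<comment> \<open>The choice \<open>t = a / (b + 1)\<close> keeps the denominator positive when
    \<open>b = 0\<close> and gives \<open>t * b \<le> a < 2 * a\<close>.\<close>
  have "0 \<le> a / (b + 1) * (a / (b + 1) * b - 2 * a)"
    using t[of "a / (b + 1)"] by (simp add: algebra_simps)
  moreover have "a / (b + 1) * b - 2 * a < 0"
  proof -
    have "a / (b + 1) * b \<le> a" using a b by (simp add: field_simps)
    then show ?thesis using a by linarith
  qed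
  moreover have "0 < a / (b + 1)" using a b by simp
  ultimately show False using mult_pos_neg[of "a / (b + 1)" "a / (b + 1) * b - 2 * a"] by linarith
qed

text \<open>Commutation gives \<open>(S + T) (S - T) = 0\<close>. Pairing this with
  \<open>y = S x - T x\<close> yields two non-negative forms with sum zero, so
  \<open>S y = T y = 0\<close>, and by symmetry
  \<open>y \<bullet> y = x \<bullet> (S y - T y) = 0\<close>.\<close>

lemma pos_sqrt_unique:
  fixes S T :: "'h::real_inner \<Rightarrow> 'h"
  assumes S: "pos_sqrt R S" and T: "pos_sqrt R T" and comm: "\<And>x. S (T x) = T (S x)"
  shows "S = T"
proof
  fix x
  have lS: "linear S" and lT: "linear T"
    using S T by (auto simp: pos_sqrt_def bounded_linear.linear)
  note S = S[unfolded pos_sqrt_def] and T = T[unfolded pos_sqrt_def]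
  define y where "y = S x - T x"
  have "S y + T y = 0"
    using S T comm by (simp add: y_def linear_diff[OF lS] linear_diff[OF lT])
  then have "S y \<bullet> y + T y \<bullet> y = 0" by (metis inner_add_left inner_zero_left)
  moreover have "0 \<le> S y \<bullet> y" "0 \<le> T y \<bullet> y" using S T by auto
  ultimately have "S y \<bullet> y = 0" "T y \<bullet> y = 0" by linarith+
  then have "S y = 0" "T y = 0"
    using positive_symmetric_zero[OF lS, of y] positive_symmetric_zero[OF lT, of y] S T by blast+
  moreover have "y \<bullet> y = x \<bullet> (S y - T y)"
  proof -
    have "y \<bullet> y = S x \<bullet> y - T x \<bullet> y" by (simp add: y_def inner_diff_left)
    also have "\<dots> = x \<bullet> S y - x \<bullet> T y" using S T by metis
    finally show ?thesis by (simp add: inner_diff_right)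
  qed
  ultimately have "y \<bullet> y = 0" by simp
  then show "S x = T x" by (simp add: y_def)
qed

text \<open>Scaled by \<open>c\<close>, \<open>R\<close> is the identity minus a strict contraction;
  the root is scaled back by \<open>1 / sqrt c\<close>. Any other root commutes with its own square
  \<open>R\<close>, hence with the constructed root, so \<open>pos_sqrt_unique\<close>
  applies.\<close>

lemma ex1_pos_sqrt:
  fixes R :: "'h::{real_inner, complete_space} \<Rightarrow> 'h"
  assumes lin: "linear R" and sym: "\<And>x y. R x \<bullet> y = x \<bullet> R y"
    and c: "c > 0" and q: "0 \<le> q" "q < 1" and R: "\<And>x. norm (x - c *\<^sub>R R x) \<le> q * norm x"
  shows "\<exists>!S. pos_sqrt R S"
proof -
  let ?K = "\<lambda>x. x - c *\<^sub>R R x"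
  have lK: "linear ?K" using lin by (simp add: linear_iff algebra_simps)
  have sK: "?K x \<bullet> y = x \<bullet> ?K y" for x y
    by (simp add: inner_diff_left inner_diff_right sym)
  obtain S where S: "pos_sqrt (\<lambda>x. x - ?K x) S"
    and comm: "\<And>T x. bounded_linear T \<Longrightarrow> (\<And>x. T (?K x) = ?K (T x)) \<Longrightarrow> T (S x) = S (T x)"
    by (rule pos_sqrt_one_minus_exists[of ?K q, OF lK sK R q]) blast
  note S' = S[unfolded pos_sqrt_def]
  have lS: "linear S" using S' bounded_linear.linear by blast
  define U where "U = (\<lambda>x. (1 / sqrt c) *\<^sub>R S x)"
  have "U (U x) = R x" for x
    using S' c by (simp add: U_def linear_scale[OF lS])
  moreover have "bounded_linear U"
    unfolding U_def using S' by (intro bounded_linear_compose[OF bounded_linear_scaleR_right]) auto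
  ultimately have U: "pos_sqrt R U"
    unfolding pos_sqrt_def using S' c by (auto simp: U_def)
  have "T = U" if T: "pos_sqrt R T" for T
  proof (rule pos_sqrt_unique[OF T U])
    fix x
    note T' = T[unfolded pos_sqrt_def]
    have lT: "linear T" using T' bounded_linear.linear by blast
    have "T (R x) = R (T x)" for x using T' by metis
    then have "T (S x) = S (T x)"
      using comm[of T x] T' by (auto simp: linear_diff[OF lT] linear_scale[OF lT])
    then show "T (U x) = U (T x)" by (simp add: U_def linear_scale[OF lT])
  qed
  with U show ?thesis by blast
qed

text \<open>For a two-sided inverse \<open>R\<close> the two equations in \<open>inv_sqrt_op\<close>
  reduce to \<open>S (S x) = R x\<close>; unique existence then gives the definite description its
  meaning.\<close>

lemma pos_sqrt_inv_sqrt_op: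
  fixes A R :: "'h::{real_inner, complete_space} \<Rightarrow> 'h"
  assumes ex1: "\<exists>!S. pos_sqrt R S" and AR: "\<And>x. A (R x) = x" and RA: "\<And>x. R (A x) = x"
  shows "pos_sqrt R (inv_sqrt_op A)"
proof -
  have "(\<forall>x. S (S (A x)) = x) \<and> (\<forall>x. A (S (S x)) = x) \<longleftrightarrow> (\<forall>x. S (S x) = R x)" for S
    using AR RA by metis
  then have "inv_sqrt_op A = (THE S. pos_sqrt R S)"
    unfolding inv_sqrt_op_def pos_sqrt_def by simp
  then show ?thesis using theI'[OF ex1] by simp
qed

subsection \<open>Regularised Gram operators\<close>

lemma reg_gram_op_0: "reg_gram_op \<rho> X 0 w v = \<rho> *\<^sub>R v"
  by (simp add: reg_gram_op_def gram_op_def)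

lemma reg_gram_op_Suc:
  "reg_gram_op \<rho> X (Suc t) w v = reg_gram_op \<rho> X t w v + (X (Suc t) w \<bullet> v) *\<^sub>R X (Suc t) w"
  by (simp add: reg_gram_op_def gram_op_def rank1_op_def)

lemma linear_gram_op: "linear (gram_op X t w)"
  by (simp add: gram_op_def rank1_op_def linear_iff inner_add_right scaleR_add_left sum.distrib
      scaleR_sum_right)

lemma linear_reg_gram_op: "linear (reg_gram_op \<rho> X t w)"
  using linear_gram_op[of X t w] by (simp add: reg_gram_op_def linear_iff algebra_simps)

text \<open>The Sherman--Morrison recursion for the inverse of \<open>reg_gram_op\<close>. It makes measurability in
  \<open>w\<close> evident and turns monotonicity in \<open>t\<close> into a one-line computation.\<close>

fun reg_gram_inv :: "real \<Rightarrow> (nat \<Rightarrow> 'w \<Rightarrow> 'h::real_inner) \<Rightarrow> nat \<Rightarrow> 'w \<Rightarrow> 'h \<Rightarrow> 'h" where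
  "reg_gram_inv \<rho> X 0 w v = (1 / \<rho>) *\<^sub>R v"
| "reg_gram_inv \<rho> X (Suc t) w v = reg_gram_inv \<rho> X t w v
     - ((X (Suc t) w \<bullet> reg_gram_inv \<rho> X t w v)
         / (1 + X (Suc t) w \<bullet> reg_gram_inv \<rho> X t w (X (Suc t) w)))
       *\<^sub>R reg_gram_inv \<rho> X t w (X (Suc t) w)"

lemma linear_reg_gram_inv: "linear (reg_gram_inv \<rho> X t w)"
proof (induction t)
  case 0
  show ?case by (simp add: linear_iff algebra_simps)
next
  case (Suc t)
  then show ?case
    by (simp add: linear_iff inner_add_right algebra_simps add_divide_distrib)
qed

lemma reg_gram_inv_symmetric:
  "reg_gram_inv \<rho> X t w u \<bullet> v = u \<bullet> reg_gram_inv \<rho> X t w v"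
proof (induction t arbitrary: u v)
  case 0
  show ?case by simp
next
  case (Suc t)
  show ?case
    using Suc[of u v] Suc[of "X (Suc t) w" v] Suc[of "X (Suc t) w" u]
    by (simp add: inner_diff_left inner_diff_right inner_commute)
qed

text \<open>One induction proves both claims: non-negativity at \<open>t\<close> keeps the
  denominator \<open>1 + s\<close> at least 1, as the inverse identity at \<open>Suc t\<close>
  requires, and that identity turns \<open>v \<bullet> ?R' v\<close> into a value of the
  non-negative form of \<open>reg_gram_op\<close>.\<close>

lemma
  assumes \<rho>: "\<rho> > 0"
  shows reg_gram_inv_right: "reg_gram_op \<rho> X t w (reg_gram_inv \<rho> X t w v) = v"
    and reg_gram_inv_nonneg: "0 \<le> v \<bullet> reg_gram_inv \<rho> X t w v"
proof -
  have "reg_gram_op \<rho> X t w (reg_gram_inv \<rho> X t w v) = v \<and> 0 \<le> v \<bullet> reg_gram_inv \<rho> X t w v"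
  proof (induction t arbitrary: v)
    case 0
    show ?case using \<rho> by (simp add: reg_gram_op_0)
  next
    case (Suc t)
    let ?A = "reg_gram_op \<rho> X t w" and ?R = "reg_gram_inv \<rho> X t w" and ?x = "X (Suc t) w"
    let ?R' = "reg_gram_inv \<rho> X (Suc t) w"
    define s where "s = ?x \<bullet> ?R ?x"
    define c where "c = ?x \<bullet> ?R v"
    have s: "0 \<le> s" using Suc by (simp add: s_def)
    have R': "?R' v = ?R v - (c / (1 + s)) *\<^sub>R ?R ?x" by (simp add: s_def c_def)
    have "reg_gram_op \<rho> X (Suc t) w (?R' v)
        = ?A (?R v) - (c / (1 + s)) *\<^sub>R ?A (?R ?x) + (c - c / (1 + s) * s) *\<^sub>R ?x"
      unfolding R' reg_gram_op_Suc
      by (simp add: linear_diff[OF linear_reg_gram_op] linear_scale[OF linear_reg_gram_op]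
          inner_diff_right s_def c_def)
    also have "c - c / (1 + s) * s = c / (1 + s)" using s by (simp add: field_simps)
    finally have A: "reg_gram_op \<rho> X (Suc t) w (?R' v) = v" using Suc by simp
    then have "v \<bullet> ?R' v = \<rho> * (?R' v \<bullet> ?R' v) + gram_op X (Suc t) w (?R' v) \<bullet> ?R' v"
      by (metis reg_gram_op_def inner_add_left inner_scaleR_left)
    moreover have "0 \<le> gram_op X (Suc t) w u \<bullet> u" for u
      unfolding gram_op_def rank1_op_def inner_sum_left by (intro sum_nonneg) simp
    ultimately show ?case using A \<rho> by simp
  qed
  then show "reg_gram_op \<rho> X t w (reg_gram_inv \<rho> X t w v) = v" "0 \<le> v \<bullet> reg_gram_inv \<rho> X t w v"
    by blast+
qed

lemma reg_gram_op_inj: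
  assumes \<rho>: "\<rho> > 0" and z: "reg_gram_op \<rho> X t w u = 0"
  shows "u = 0"
proof -
  have "0 \<le> gram_op X t w u \<bullet> u"
    unfolding gram_op_def rank1_op_def inner_sum_left by (intro sum_nonneg) simp
  moreover have "0 = \<rho> * (u \<bullet> u) + gram_op X t w u \<bullet> u"
    using z by (metis reg_gram_op_def inner_add_left inner_scaleR_left inner_zero_left)
  moreover have "0 \<le> \<rho> * (u \<bullet> u)" using \<rho> by simp
  ultimately have "\<rho> * (u \<bullet> u) = 0" by linarith
  then show ?thesis using \<rho> by simp
qed

lemma reg_gram_inv_left:
  assumes \<rho>: "\<rho> > 0"
  shows "reg_gram_inv \<rho> X t w (reg_gram_op \<rho> X t w v) = v"
proof -
  have "reg_gram_op \<rho> X t w (reg_gram_inv \<rho> X t w (reg_gram_op \<rho> X t w v) - v) = 0"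
    using reg_gram_inv_right[OF \<rho>] by (simp add: linear_diff[OF linear_reg_gram_op])
  then show ?thesis using reg_gram_op_inj[OF \<rho>] by fastforce
qed

text \<open>This is the contraction that the square-root iteration needs. For
  \<open>x = \<rho> *\<^sub>R u + v\<close> with \<open>v\<close> the Gram image of
  \<open>u\<close>, the operator sends \<open>x\<close> to \<open>v\<close>. As
  \<open>u \<bullet> v \<ge> 0\<close>, dropping the cross term and using
  \<open>norm v \<le> L * norm u\<close> gives
  \<open>k * (norm v)\<^sup>2 \<le> (norm x)\<^sup>2\<close> with \<open>k > 1\<close>.\<close>

lemma norm_one_minus_reg_gram_inv:
  assumes \<rho>: "\<rho> > 0"
  obtains q where "0 \<le> q" "q < 1" "\<And>x. norm (x - \<rho> *\<^sub>R reg_gram_inv \<rho> X t w x) \<le> q * norm x"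
proof -
  \<comment> \<open>The added 1 keeps \<open>L\<close> positive even if every \<open>X i w\<close>
    vanishes.\<close>
  define L where "L = 1 + (\<Sum>i\<in>{1..t}. (norm (X i w))\<^sup>2)"
  have L: "L \<ge> 1" by (simp add: L_def sum_nonneg)
  have gb: "norm (gram_op X t w u) \<le> L * norm u" for u
  proof -
    have "norm (gram_op X t w u) \<le> (\<Sum>i\<in>{1..t}. (norm (X i w))\<^sup>2 * norm u)"
      unfolding gram_op_def rank1_op_def
    proof (rule sum_norm_le)
      fix i
      have "\<bar>X i w \<bullet> u\<bar> * norm (X i w) \<le> (norm (X i w) * norm u) * norm (X i w)"
        by (intro mult_right_mono Cauchy_Schwarz_ineq2) simp
      then show "norm ((X i w \<bullet> u) *\<^sub>R X i w) \<le> (norm (X i w))\<^sup>2 * norm u"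
        by (simp add: power2_eq_square algebra_simps)
    qed
    also have "\<dots> \<le> L * norm u" by (simp add: L_def sum_distrib_right[symmetric] distrib_right)
    finally show ?thesis .
  qed
  define k where "k = \<rho>\<^sup>2 / L\<^sup>2 + 1"
  have k: "k > 1" using \<rho> L by (simp add: k_def)
  have "norm (x - \<rho> *\<^sub>R reg_gram_inv \<rho> X t w x) \<le> 1 / sqrt k * norm x" for x
  proof -
    define u where "u = reg_gram_inv \<rho> X t w x"
    define v where "v = gram_op X t w u"
    have x: "x = \<rho> *\<^sub>R u + v"
      using reg_gram_inv_right[OF \<rho>, of X t w x] by (simp add: u_def v_def reg_gram_op_def)
    have uv: "0 \<le> u \<bullet> v"
      unfolding v_def gram_op_def rank1_op_def inner_sum_right
      by (intro sum_nonneg) (simp add: inner_commute)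
    have "(norm v)\<^sup>2 \<le> (L * norm u)\<^sup>2" unfolding v_def by (intro power_mono gb) simp
    then have "\<rho>\<^sup>2 / L\<^sup>2 * (norm v)\<^sup>2 \<le> \<rho>\<^sup>2 / L\<^sup>2 * (L * norm u)\<^sup>2"
      by (intro mult_left_mono) auto
    also have "\<dots> = \<rho>\<^sup>2 * (norm u)\<^sup>2" using L by (simp add: power_mult_distrib)
    finally have "k * (norm v)\<^sup>2 \<le> \<rho>\<^sup>2 * (norm u)\<^sup>2 + (norm v)\<^sup>2" by (simp add: k_def algebra_simps)
    also have "\<dots> \<le> \<rho>\<^sup>2 * (norm u)\<^sup>2 + 2 * (\<rho> * (u \<bullet> v)) + (norm v)\<^sup>2"
      using uv \<rho> by simp
    also have "\<dots> = (norm x)\<^sup>2"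
      unfolding x power2_norm_eq_inner
      by (simp add: inner_add_left inner_add_right inner_commute algebra_simps power2_eq_square)
    finally have "sqrt (k * (norm v)\<^sup>2) \<le> sqrt ((norm x)\<^sup>2)" by (rule real_sqrt_le_mono)
    then have "sqrt k * norm v \<le> norm x" by (simp add: real_sqrt_mult)
    then have "norm v \<le> 1 / sqrt k * norm x" using k by (simp add: field_simps)
    moreover have "x - \<rho> *\<^sub>R reg_gram_inv \<rho> X t w x = v"
      unfolding u_def[symmetric] using x by (metis add_diff_cancel_left')
    ultimately show ?thesis by simp
  qed
  moreover have "1 / sqrt k < 1" "0 \<le> 1 / sqrt k" using k by auto
  ultimately show ?thesis using that by blast
qed

lemma pos_sqrt_reg_gram:
  fixes X :: "nat \<Rightarrow> 'w \<Rightarrow> 'h::{real_inner, complete_space}"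
  assumes \<rho>: "\<rho> > 0"
  shows "pos_sqrt (reg_gram_inv \<rho> X t w) (inv_sqrt_op (reg_gram_op \<rho> X t w))"
proof (rule pos_sqrt_inv_sqrt_op)
  obtain q where "0 \<le> q" "q < 1" "\<And>x. norm (x - \<rho> *\<^sub>R reg_gram_inv \<rho> X t w x) \<le> q * norm x"
    by (rule norm_one_minus_reg_gram_inv[OF \<rho>, of X t w]) blast
  then show "\<exists>!S. pos_sqrt (reg_gram_inv \<rho> X t w) S"
    by (rule ex1_pos_sqrt[OF linear_reg_gram_inv reg_gram_inv_symmetric \<rho>])
qed (simp_all add: reg_gram_inv_right[OF \<rho>] reg_gram_inv_left[OF \<rho>])

text \<open>Inner products of whitened vectors thus depend only on the explicit inverse, so
  measurability and monotonicity can be read off without touching the square root.\<close>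

lemma inner_inv_sqrt_reg_gram:
  fixes X :: "nat \<Rightarrow> 'w \<Rightarrow> 'h::{real_inner, complete_space}"
  assumes "\<rho> > 0"
  shows "inv_sqrt_op (reg_gram_op \<rho> X t w) u \<bullet> inv_sqrt_op (reg_gram_op \<rho> X t w) v
    = u \<bullet> reg_gram_inv \<rho> X t w v"
  using pos_sqrt_reg_gram[OF assms, of X t w] by (simp add: pos_sqrt_def)

lemma norm_inv_sqrt_reg_gram:
  fixes X :: "nat \<Rightarrow> 'w \<Rightarrow> 'h::{real_inner, complete_space}"
  assumes "\<rho> > 0"
  shows "norm (inv_sqrt_op (reg_gram_op \<rho> X t w) v) = sqrt (v \<bullet> reg_gram_inv \<rho> X t w v)"
  by (simp add: norm_eq_sqrt_inner inner_inv_sqrt_reg_gram[OF assms])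

lemma linear_inv_sqrt_reg_gram:
  fixes X :: "nat \<Rightarrow> 'w \<Rightarrow> 'h::{real_inner, complete_space}"
  assumes "\<rho> > 0"
  shows "linear (inv_sqrt_op (reg_gram_op \<rho> X t w))"
  using pos_sqrt_reg_gram[OF assms, of X t w] bounded_linear.linear by (auto simp: pos_sqrt_def)

lemma norm_inv_sqrt_reg_gram_Suc_le:
  fixes X :: "nat \<Rightarrow> 'w \<Rightarrow> 'h::{real_inner, complete_space}"
  assumes \<rho>: "\<rho> > 0"
  shows "norm (inv_sqrt_op (reg_gram_op \<rho> X (Suc t) w) v) \<le> norm (inv_sqrt_op (reg_gram_op \<rho> X t w) v)"
proof -
  let ?R = "reg_gram_inv \<rho> X t w" and ?x = "X (Suc t) w"
  have "v \<bullet> reg_gram_inv \<rho> X (Suc t) w v = v \<bullet> ?R v - (?x \<bullet> ?R v)\<^sup>2 / (1 + ?x \<bullet> ?R ?x)"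
    using reg_gram_inv_symmetric[of \<rho> X t w v ?x]
    by (simp add: inner_diff_right power2_eq_square inner_commute)
  also have "\<dots> \<le> v \<bullet> ?R v" using reg_gram_inv_nonneg[OF \<rho>, of ?x X t w] by simp
  finally show ?thesis unfolding norm_inv_sqrt_reg_gram[OF \<rho>] by (rule real_sqrt_le_mono)
qed

text \<open>The vector is whitened by an operator that already contains it: if \<open>s\<close> is
  its value under the previous inverse, the recursion turns \<open>s\<close> into
  \<open>s / (1 + s)\<close>.\<close>

lemma norm_inv_sqrt_reg_gram_le_1:
  fixes X :: "nat \<Rightarrow> 'w \<Rightarrow> 'h::{real_inner, complete_space}"
  assumes \<rho>: "\<rho> > 0"
  shows "norm (inv_sqrt_op (reg_gram_op \<rho> X (Suc t) w) (X (Suc t) w)) \<le> 1"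
proof -
  define s where "s = X (Suc t) w \<bullet> reg_gram_inv \<rho> X t w (X (Suc t) w)"
  have s: "0 \<le> s" by (simp add: s_def reg_gram_inv_nonneg[OF \<rho>])
  have "X (Suc t) w \<bullet> reg_gram_inv \<rho> X (Suc t) w (X (Suc t) w) = s - s / (1 + s) * s"
    by (simp add: inner_diff_right s_def)
  also have "\<dots> \<le> 1" using s by (simp add: field_simps)
  finally show ?thesis unfolding norm_inv_sqrt_reg_gram[OF \<rho>] by simp
qed

text \<open>The induction runs over all measurable \<open>v\<close>, since the recursion evaluates
  the previous inverse both at \<open>v\<close> and at \<open>X (Suc t)\<close>.\<close>

lemma measurable_reg_gram_inv:
  fixes X :: "nat \<Rightarrow> 'w \<Rightarrow> 'h::{real_inner, second_countable_topology}"
  assumes "\<And>i. i \<in> {1..t} \<Longrightarrow> X i \<in> borel_measurable N" and "v \<in> borel_measurable N"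
  shows "(\<lambda>w. reg_gram_inv \<rho> X t w (v w)) \<in> borel_measurable N"
  using assms
proof (induction t arbitrary: v)
  case 0
  then show ?case by simp
next
  case (Suc t)
  have [measurable]: "X (Suc t) \<in> borel_measurable N" using Suc.prems(1) by simp
  have [measurable]: "(\<lambda>w. reg_gram_inv \<rho> X t w (u w)) \<in> borel_measurable N"
    if "u \<in> borel_measurable N" for u
    using Suc that by simp
  show ?case using Suc.prems(2) by (simp del: One_nat_def)
qed

subsection \<open>Pinelis' inequality\<close>

lemma cosh_sqrt_sums: "(\<lambda>k. s ^ k / fact (2 * k)) sums cosh (sqrt s)" if "0 \<le> s" for s :: real
proof -
  have "(\<lambda>n. if even n then sqrt s ^ n /\<^sub>R fact n else 0) sums cosh (sqrt s)"
    by (rule cosh_converges)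
  then have "(\<lambda>k. sqrt s ^ (2 * k) /\<^sub>R fact (2 * k)) sums cosh (sqrt s)"
    using sums_mono_reindex[of "\<lambda>k. 2 * k" "\<lambda>n. if even n then sqrt s ^ n /\<^sub>R fact n else 0" "cosh (sqrt s)"]
    by (fastforce simp: strict_mono_def elim!: evenE)
  then show ?thesis using that by (simp add: power_mult divide_inverse mult.commute[of "_ ^ _"])
qed

lemma convex_on_power_nonneg: "convex_on {0..} (\<lambda>x::real. x ^ k)"
  using convex_power_even[of k] convex_power_odd[of k] convex_on_subset
  by (cases "even k") auto

text \<open>The power series of \<open>cosh (sqrt s)\<close> in \<open>s\<close> has only
  non-negative coefficients, so convexity passes from the monomials to the sum.\<close>

lemma convex_on_cosh_sqrt: "convex_on {0..} (\<lambda>s::real. cosh (sqrt s))"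
proof (rule convex_onI)
  fix t x y :: real
  assume t: "0 < t" "t < 1" and "x \<in> {0..}" "y \<in> {0..}"
  then have xy: "0 \<le> x" "0 \<le> y" by auto
  have z: "0 \<le> (1 - t) *\<^sub>R x + t *\<^sub>R y" using t xy by simp
  have "((1 - t) *\<^sub>R x + t *\<^sub>R y) ^ k / fact (2 * k)
      \<le> (1 - t) * (x ^ k / fact (2 * k)) + t * (y ^ k / fact (2 * k))" for k
  proof -
    have "((1 - t) *\<^sub>R x + t *\<^sub>R y) ^ k \<le> (1 - t) * x ^ k + t * y ^ k"
      using convex_onD[OF convex_on_power_nonneg[of k], of t x y] t xy by simp
    then show ?thesis by (simp add: divide_right_mono add_divide_distrib[symmetric])
  qed
  then show "cosh (sqrt ((1 - t) *\<^sub>R x + t *\<^sub>R y)) \<le> (1 - t) * cosh (sqrt x) + t * cosh (sqrt y)"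
    by (rule sums_le[OF _ cosh_sqrt_sums[OF z]
        sums_add[OF sums_mult[OF cosh_sqrt_sums[OF xy(1)]] sums_mult[OF cosh_sqrt_sums[OF xy(2)]]]])
qed simp

lemma sinh_ge_self: "0 \<le> b \<Longrightarrow> b \<le> sinh b" for b :: real
  using real_le_x_sinh[of b] by (cases "b = 0") (auto simp: sinh_field_def exp_minus)

text \<open>Since \<open>s \<mapsto> cosh (sqrt s)\<close> is convex, the left side is convex in \<open>c\<close> while the right side is
  affine, so only the extreme cases \<open>c = a * b\<close> and \<open>c = - a * b\<close> matter.\<close>

lemma cosh_sqrt_quadratic_le:
  fixes a b c :: real
  assumes a: "0 \<le> a" and b: "0 \<le> b" and c: "\<bar>c\<bar> \<le> a * b"
  shows "cosh (sqrt (a\<^sup>2 + 2 * c + b\<^sup>2)) \<le> cosh a * (exp b - b) + c * (sinh a / a)"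
proof (cases "a * b = 0")
  case True
  \<comment> \<open>If \<open>a = 0\<close>, division by zero makes \<open>sinh a / a\<close> equal
    to 0; this does no harm because \<open>c = 0\<close> as well.\<close>
  then have "c = 0" using c unfolding True by simp
  moreover have "cosh b \<le> exp b - b"
    using sinh_ge_self[OF b] by (simp add: cosh_plus_sinh[symmetric])
  ultimately show ?thesis using True a b by auto
next
  case False
  then have ab: "a > 0" "b > 0" using a b by auto
  \<comment> \<open>\<open>t\<close> is the weight that makes
    \<open>a\<^sup>2 + 2 * c + b\<^sup>2\<close> a convex combination of
    \<open>(a - b)\<^sup>2\<close> and \<open>(a + b)\<^sup>2\<close>.\<close>
  define t where "t = (1 + c / (a * b)) / 2"
  have "c / (a * b) \<le> 1" "- 1 \<le> c / (a * b)" using c ab by (auto simp: field_simps)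
  then have t: "0 \<le> t" "t \<le> 1" by (auto simp: t_def)
  have ct: "c = (2 * t - 1) * (a * b)" using ab by (simp add: t_def add_divide_distrib)
  have "a\<^sup>2 + 2 * c + b\<^sup>2 = (1 - t) *\<^sub>R (a - b)\<^sup>2 + t *\<^sub>R (a + b)\<^sup>2"
    unfolding ct by (simp add: power2_eq_square algebra_simps)
  then have "cosh (sqrt (a\<^sup>2 + 2 * c + b\<^sup>2)) \<le> (1 - t) * cosh (sqrt ((a - b)\<^sup>2)) + t * cosh (sqrt ((a + b)\<^sup>2))"
    using convex_onD[OF convex_on_cosh_sqrt t, of "(a - b)\<^sup>2" "(a + b)\<^sup>2"] by simp
  also have "\<dots> = (1 - t) * cosh (a - b) + t * cosh (a + b)"
    by simp
  also have "\<dots> \<le> (1 - t) * (cosh a * (exp b - b) - b * sinh a) + t * (cosh a * (exp b - b) + b * sinh a)"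
  proof -
    \<comment> \<open>At the two extremes the gap is \<open>exp a\<close> or
      \<open>exp (- a)\<close> times \<open>sinh b - b\<close>, hence non-negative.\<close>
    have s: "0 \<le> sinh b - b" using sinh_ge_self[OF b] by simp
    have "cosh a * (exp b - b) - b * sinh a - cosh (a - b) = (cosh a + sinh a) * (sinh b - b)"
      unfolding cosh_diff by (simp add: cosh_plus_sinh[symmetric] algebra_simps)
    moreover have "cosh a * (exp b - b) + b * sinh a - cosh (a + b) = (cosh a - sinh a) * (sinh b - b)"
      unfolding cosh_add by (simp add: cosh_plus_sinh[symmetric] algebra_simps)
    moreover have "0 \<le> cosh a + sinh a" "0 \<le> cosh a - sinh a"
      by (simp_all add: cosh_plus_sinh cosh_minus_sinh)
    ultimately have "cosh (a - b) \<le> cosh a * (exp b - b) - b * sinh a"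
      "cosh (a + b) \<le> cosh a * (exp b - b) + b * sinh a"
      using s by (metis diff_ge_0_iff_ge mult_nonneg_nonneg)+
    then show ?thesis using t by (intro add_mono mult_left_mono) auto
  qed
  also have "\<dots> = cosh a * (exp b - b) + c * (sinh a / a)"
    unfolding ct using ab by (simp add: field_simps)
  finally show ?thesis .
qed

text \<open>The series of \<open>exp b - b\<close> has no first-order term: the first order in
  \<open>u\<close> sits in \<open>x \<bullet> u\<close> alone, which conditional centering will
  remove.\<close>

lemma cosh_norm_add_le:
  fixes x u :: "'h::real_inner"
  shows "cosh (norm (x + u)) \<le> cosh (norm x) * (exp (norm u) - norm u) + (x \<bullet> u) * (sinh (norm x) / norm x)"
proof -
  have "norm (x + u) = sqrt ((norm x)\<^sup>2 + 2 * (x \<bullet> u) + (norm u)\<^sup>2)"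
    by (simp add: norm_eq_sqrt_inner inner_add_left inner_add_right inner_commute)
  then show ?thesis
    using cosh_sqrt_quadratic_le[OF norm_ge_zero norm_ge_zero Cauchy_Schwarz_ineq2[of x u]] by simp
qed

subsection \<open>Conditional moment generating functions and a maximal inequality\<close>

lemma exp_minus_self_sums:
  "(\<lambda>k. b ^ (k + 2) / fact (k + 2)) sums (exp b - b - 1)" for b :: real
proof -
  have "(\<lambda>k. b ^ (k + 2) /\<^sub>R fact (k + 2)) sums (exp b - (\<Sum>i<2. b ^ i /\<^sub>R fact i))"
    by (rule sums_split_initial_segment[OF exp_converges])
  also have "(\<Sum>i<2. b ^ i /\<^sub>R fact i) = 1 + b" by (simp add: numeral_2_eq_2)
  finally show ?thesis by (simp add: divide_inverse mult.commute algebra_simps)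
qed

text \<open>The weight \<open>f\<close> makes this a conditional bound in integrated form. All terms
  are non-negative and taken in \<open>ennreal\<close>, so the exponential series is integrated
  termwise with no integrability known in advance.\<close>

lemma (in sigma_finite_subalgebra) nn_integral_bernstein_mgf:
  fixes \<epsilon> \<sigma> g f :: "'a \<Rightarrow> real"
  assumes \<epsilon>[measurable]: "\<epsilon> \<in> borel_measurable M"
    and F[measurable]: "\<sigma> \<in> borel_measurable F" "g \<in> borel_measurable F" "f \<in> borel_measurable F"
    and f: "\<And>w. 0 \<le> f w" and g: "\<And>w. 0 \<le> g w" "\<And>w. g w \<le> 1"
    and B: "0 \<le> B" "0 \<le> l" "l * B < 1"
    and bernstein: "\<And>m. m \<ge> 2 \<Longrightarrow> AE w in M. nn_cond_exp M F (\<lambda>v. ennreal (\<bar>\<epsilon> v\<bar> ^ m)) w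
                       \<le> ennreal (fact m / 2 * B ^ (m - 2) * (\<sigma> w)\<^sup>2)"
  shows "(\<integral>\<^sup>+w. ennreal (f w * (exp (l * \<bar>\<epsilon> w\<bar> * g w) - l * \<bar>\<epsilon> w\<bar> * g w)) \<partial>M)
    \<le> (\<integral>\<^sup>+w. ennreal (f w * exp (l\<^sup>2 / (2 * (1 - l * B)) * ((\<sigma> w)\<^sup>2 * (g w)\<^sup>2))) \<partial>M)"
proof -
  note M[measurable] = F[THEN measurable_from_subalg[OF subalg]]
  let ?a = "\<lambda>k w. f w * (l * g w) ^ (k + 2) / fact (k + 2)"
  let ?b = "\<lambda>k w. f w * (l\<^sup>2 / 2 * ((\<sigma> w)\<^sup>2 * (g w)\<^sup>2)) * (l * B) ^ k"
  have "ennreal (f w * (exp (l * \<bar>\<epsilon> w\<bar> * g w) - l * \<bar>\<epsilon> w\<bar> * g w))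
      = ennreal (f w) + (\<Sum>k. ennreal (?a k w) * ennreal (\<bar>\<epsilon> w\<bar> ^ (k + 2)))" for w
  proof -
    define b where "b = l * \<bar>\<epsilon> w\<bar> * g w"
    have b: "0 \<le> b" using B g by (simp add: b_def)
    have "(\<lambda>k. f w * (b ^ (k + 2) / fact (k + 2))) sums (f w * (exp b - b - 1))"
      by (intro sums_mult exp_minus_self_sums)
    then have "(\<Sum>k. ennreal (f w * (b ^ (k + 2) / fact (k + 2)))) = ennreal (f w * (exp b - b - 1))"
      using f b by (intro suminf_ennreal_eq) auto
    moreover have "ennreal (f w * (b ^ (k + 2) / fact (k + 2))) = ennreal (?a k w) * ennreal (\<bar>\<epsilon> w\<bar> ^ (k + 2))" for k
      using f B g by (subst ennreal_mult[symmetric]) (auto simp: b_def power_mult_distrib field_simps)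
    moreover have "ennreal (f w) + ennreal (f w * (exp b - b - 1)) = ennreal (f w * (exp b - b))"
    proof (subst ennreal_plus[symmetric])
      show "0 \<le> f w * (exp b - b - 1)"
        using f[of w] exp_ge_add_one_self[of b] by (intro mult_nonneg_nonneg) linarith+
    qed (use f in \<open>auto simp: algebra_simps\<close>)
    ultimately show ?thesis by (simp add: b_def)
  qed
  then have "(\<integral>\<^sup>+w. ennreal (f w * (exp (l * \<bar>\<epsilon> w\<bar> * g w) - l * \<bar>\<epsilon> w\<bar> * g w)) \<partial>M)
      = (\<integral>\<^sup>+w. ennreal (f w) \<partial>M) + (\<Sum>k. \<integral>\<^sup>+w. ennreal (?a k w) * ennreal (\<bar>\<epsilon> w\<bar> ^ (k + 2)) \<partial>M)"
    by (simp add: nn_integral_add nn_integral_suminf)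
  also have "\<dots> \<le> (\<integral>\<^sup>+w. ennreal (f w) \<partial>M) + (\<Sum>k. \<integral>\<^sup>+w. ennreal (?b k w) \<partial>M)"
  proof (intro add_left_mono suminf_le summableI)
    fix k
    have "(\<integral>\<^sup>+w. ennreal (?a k w) * ennreal (\<bar>\<epsilon> w\<bar> ^ (k + 2)) \<partial>M)
      = (\<integral>\<^sup>+w. ennreal (?a k w) * nn_cond_exp M F (\<lambda>v. ennreal (\<bar>\<epsilon> v\<bar> ^ (k + 2))) w \<partial>M)"
      by (rule nn_cond_exp_intg[symmetric]) measurable
    also have "\<dots> \<le> (\<integral>\<^sup>+w. ennreal (?b k w) \<partial>M)"
    proof (rule nn_integral_mono_AE)
      show "AE w in M. ennreal (?a k w) * nn_cond_exp M F (\<lambda>v. ennreal (\<bar>\<epsilon> v\<bar> ^ (k + 2))) w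
        \<le> ennreal (?b k w)"
        using bernstein[of "k + 2", OF le_add2]
      proof (rule eventually_mono)
        fix w
        assume 1: "nn_cond_exp M F (\<lambda>v. ennreal (\<bar>\<epsilon> v\<bar> ^ (k + 2))) w
          \<le> ennreal (fact (k + 2) / 2 * B ^ (k + 2 - 2) * (\<sigma> w)\<^sup>2)"
        let ?c = "fact (k + 2) / 2 * B ^ k * (\<sigma> w)\<^sup>2"
        have a: "0 \<le> ?a k w" using f B g by simp
        have "ennreal (?a k w) * nn_cond_exp M F (\<lambda>v. ennreal (\<bar>\<epsilon> v\<bar> ^ (k + 2))) w
          \<le> ennreal (?a k w) * ennreal ?c"
          using 1 by (intro mult_left_mono) auto
        also have "\<dots> = ennreal (?a k w * ?c)" using a B by (intro ennreal_mult[symmetric]) auto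
        also have "\<dots> \<le> ennreal (?b k w)"
        proof (rule ennreal_leI)
          have "?a k w * ?c = f w * (l * g w) ^ (k + 2) * B ^ k * (\<sigma> w)\<^sup>2 / 2"
            by (simp del: fact_Suc add_2_eq_Suc')
          also have "\<dots> = ?b k w * g w ^ k"
            by (simp add: power_mult_distrib power_add algebra_simps power2_eq_square)
          \<comment> \<open>Two of the \<open>k + 2\<close> factors \<open>g w\<close> stay for the
            variance term; the other \<open>k\<close> are bounded by 1, which leaves a geometric
            series of ratio \<open>l * B\<close>.\<close>
          also have "\<dots> \<le> ?b k w * 1"
            using f B g by (intro mult_left_mono power_le_one) auto
          finally show "?a k w * ?c \<le> ?b k w" by simp
        qed
        finally show "ennreal (?a k w) * nn_cond_exp M F (\<lambda>v. ennreal (\<bar>\<epsilon> v\<bar> ^ (k + 2))) w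
          \<le> ennreal (?b k w)" .
      qed
    qed
    finally show "(\<integral>\<^sup>+w. ennreal (?a k w) * ennreal (\<bar>\<epsilon> w\<bar> ^ (k + 2)) \<partial>M) \<le> (\<integral>\<^sup>+w. ennreal (?b k w) \<partial>M)" .
  qed
  also have "\<dots> = (\<integral>\<^sup>+w. ennreal (f w) + (\<Sum>k. ennreal (?b k w)) \<partial>M)"
    by (simp add: nn_integral_add nn_integral_suminf)
  also have "\<dots> \<le> (\<integral>\<^sup>+w. ennreal (f w * exp (l\<^sup>2 / (2 * (1 - l * B)) * ((\<sigma> w)\<^sup>2 * (g w)\<^sup>2))) \<partial>M)"
  proof (rule nn_integral_mono)
    fix w
    define u where "u = l\<^sup>2 / 2 * ((\<sigma> w)\<^sup>2 * (g w)\<^sup>2)"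
    have u: "0 \<le> u" by (simp add: u_def)
    have "(\<lambda>k. f w * u * (l * B) ^ k) sums (f w * u * (1 / (1 - l * B)))"
      using B by (intro sums_mult geometric_sums) auto
    then have "(\<Sum>k. ennreal (?b k w)) = ennreal (f w * u * (1 / (1 - l * B)))"
      using f u B unfolding u_def[symmetric] by (intro suminf_ennreal_eq) auto
    then have "ennreal (f w) + (\<Sum>k. ennreal (?b k w)) = ennreal (f w * (1 + u / (1 - l * B)))"
      using f u B by (subst ennreal_plus[symmetric] | simp add: algebra_simps)+
    also have "\<dots> \<le> ennreal (f w * exp (u / (1 - l * B)))"
      using f by (intro ennreal_leI mult_left_mono exp_ge_add_one_self)
    also have "u / (1 - l * B) = l\<^sup>2 / (2 * (1 - l * B)) * ((\<sigma> w)\<^sup>2 * (g w)\<^sup>2)"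
      by (simp add: u_def)
    finally show "ennreal (f w) + (\<Sum>k. ennreal (?b k w))
      \<le> ennreal (f w * exp (l\<^sup>2 / (2 * (1 - l * B)) * ((\<sigma> w)\<^sup>2 * (g w)\<^sup>2)))" .
  qed
  finally show ?thesis .
qed

text \<open>The bound \<open>K\<close> serves integrability: it makes the Bernstein estimate finite,
  hence \<open>P\<close> integrable, and it dominates \<open>h w * \<epsilon> w\<close>. Only then
  can the linear term be split off and integrated to zero.\<close>

lemma (in finite_measure_subalgebra) nn_integral_supermartingale_step:
  fixes \<epsilon> \<sigma> g f h Y :: "'a \<Rightarrow> real"
  assumes \<epsilon>: "integrable M \<epsilon>" and \<epsilon>0: "AE w in M. real_cond_exp M F \<epsilon> w = 0"
    and F[measurable]: "\<sigma> \<in> borel_measurable F" "g \<in> borel_measurable F" "f \<in> borel_measurable F"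
      "h \<in> borel_measurable F"
    and f: "\<And>w. 0 \<le> f w" and g: "\<And>w. 0 \<le> g w" "\<And>w. g w \<le> 1"
    and B: "0 \<le> B" "0 \<le> l" "l * B < 1"
    and bernstein: "\<And>m. m \<ge> 2 \<Longrightarrow> AE w in M. nn_cond_exp M F (\<lambda>v. ennreal (\<bar>\<epsilon> v\<bar> ^ m)) w
                       \<le> ennreal (fact m / 2 * B ^ (m - 2) * (\<sigma> w)\<^sup>2)"
    and Y: "\<And>w. 0 \<le> Y w"
      "\<And>w. Y w \<le> f w * (exp (l * \<bar>\<epsilon> w\<bar> * g w) - l * \<bar>\<epsilon> w\<bar> * g w) + h w * \<epsilon> w"
    and fK: "\<And>w. f w * exp (l\<^sup>2 / (2 * (1 - l * B)) * ((\<sigma> w)\<^sup>2 * (g w)\<^sup>2)) \<le> K"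
    and hK: "\<And>w. \<bar>h w\<bar> \<le> K"
  shows "(\<integral>\<^sup>+w. ennreal (Y w) \<partial>M)
    \<le> (\<integral>\<^sup>+w. ennreal (f w * exp (l\<^sup>2 / (2 * (1 - l * B)) * ((\<sigma> w)\<^sup>2 * (g w)\<^sup>2))) \<partial>M)"
    (is "_ \<le> ?R")
proof -
  note M[measurable] = F[THEN measurable_from_subalg[OF subalg]]
  have [measurable]: "\<epsilon> \<in> borel_measurable M" using \<epsilon> by simp
  define P where "P = (\<lambda>w. f w * (exp (l * \<bar>\<epsilon> w\<bar> * g w) - l * \<bar>\<epsilon> w\<bar> * g w))"
  have [measurable]: "P \<in> borel_measurable M" unfolding P_def by measurable
  have P: "0 \<le> P w" for w
    using f[of w] exp_ge_add_one_self[of "l * \<bar>\<epsilon> w\<bar> * g w"] unfolding P_def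
    by (intro mult_nonneg_nonneg) linarith+
  have PR: "(\<integral>\<^sup>+w. ennreal (P w) \<partial>M) \<le> ?R"
    unfolding P_def by (rule nn_integral_bernstein_mgf) (use assms in auto)
  also have "?R \<le> (\<integral>\<^sup>+w. ennreal K \<partial>M)" by (intro nn_integral_mono ennreal_leI fK)
  also have "\<dots> < \<infinity>" by (simp add: ennreal_mult_less_top less_top[symmetric] ennreal_mult_eq_top_iff)
  finally have iP: "integrable M P"
    using P by (intro integrableI_nonneg) auto
  have ih: "integrable M (\<lambda>w. h w * \<epsilon> w)"
  proof (rule Bochner_Integration.integrable_bound[where f = "\<lambda>w. K * \<epsilon> w"])
    show "AE w in M. norm (h w * \<epsilon> w) \<le> norm (K * \<epsilon> w)"
      using hK by (intro AE_I2) (auto simp: abs_mult intro!: mult_right_mono order_trans[OF hK])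
  qed (use \<epsilon> in auto)
  have "(\<integral>w. h w * \<epsilon> w \<partial>M) = (\<integral>w. h w * real_cond_exp M F \<epsilon> w \<partial>M)"
    by (rule real_cond_exp_intg(2)[symmetric, OF ih]) auto
  also have "\<dots> = (\<integral>w. 0 \<partial>M)"
    using \<epsilon>0 by (intro integral_cong_AE) auto
  finally have h0: "(\<integral>w. h w * \<epsilon> w \<partial>M) = 0" by simp
  have "(\<integral>\<^sup>+w. ennreal (Y w) \<partial>M) \<le> (\<integral>\<^sup>+w. ennreal (P w + h w * \<epsilon> w) \<partial>M)"
    using Y(2) unfolding P_def by (intro nn_integral_mono ennreal_leI)
  also have "\<dots> = ennreal (\<integral>w. P w + h w * \<epsilon> w \<partial>M)"
    using iP ih order_trans[OF Y] unfolding P_def by (intro nn_integral_eq_integral) auto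
  also have "\<dots> = ennreal (\<integral>w. P w \<partial>M)" using iP ih h0 by simp
  also have "\<dots> = (\<integral>\<^sup>+w. ennreal (P w) \<partial>M)"
    using iP P by (intro nn_integral_eq_integral[symmetric]) auto
  finally show ?thesis using PR by (rule order_trans)
qed

text \<open>\<open>E t\<close> stands for no exit up to time \<open>t\<close>. The induction carries
  \<open>c\<close> times the exited mass plus the integral of \<open>W t\<close> over the survivors;
  paths leaving at the next step exchange \<open>W (Suc t) \<ge> c\<close> for
  \<open>c\<close>.\<close>

lemma (in finite_measure) stopped_maximal_inequality:
  fixes W :: "nat \<Rightarrow> 'a \<Rightarrow> ennreal"
  assumes E: "\<And>t. t \<le> n \<Longrightarrow> E t \<in> sets M" and W: "\<And>t. t \<le> n \<Longrightarrow> W t \<in> borel_measurable M"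
    and E0: "E 0 = space M" and sub: "\<And>t. t < n \<Longrightarrow> E (Suc t) \<subseteq> E t"
    and step: "\<And>t. t < n \<Longrightarrow> (\<integral>\<^sup>+w. W (Suc t) w * indicator (E t) w \<partial>M) \<le> (\<integral>\<^sup>+w. W t w * indicator (E t) w \<partial>M)"
    and c: "\<And>t. t < n \<Longrightarrow> AE w in M. w \<in> E t - E (Suc t) \<longrightarrow> c \<le> W (Suc t) w"
  shows "c * emeasure M (space M - E n) \<le> (\<integral>\<^sup>+w. W 0 w \<partial>M)"
proof -
  have "t \<le> n \<Longrightarrow> c * emeasure M (space M - E t) + (\<integral>\<^sup>+w. W t w * indicator (E t) w \<partial>M) \<le> (\<integral>\<^sup>+w. W 0 w \<partial>M)" for t
  proof (induction t)
    case 0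
    have "(\<integral>\<^sup>+w. W 0 w * indicator (E 0) w \<partial>M) = (\<integral>\<^sup>+w. W 0 w \<partial>M)"
      unfolding E0 by (intro nn_integral_cong) auto
    then show ?case by (simp add: E0)
  next
    case (Suc t)
    then have t: "t < n" by simp
    have [measurable]: "E t \<in> sets M" "E (Suc t) \<in> sets M" "W (Suc t) \<in> borel_measurable M"
      using E W Suc.prems by auto
    have "space M - E (Suc t) = (space M - E t) \<union> (E t - E (Suc t))"
      using sub[OF t] sets.sets_into_space[of "E t" M] by auto
    moreover have "emeasure M ((space M - E t) \<union> (E t - E (Suc t)))
        = emeasure M (space M - E t) + emeasure M (E t - E (Suc t))"
      by (intro plus_emeasure[symmetric]) auto
    ultimately have "c * emeasure M (space M - E (Suc t)) + (\<integral>\<^sup>+w. W (Suc t) w * indicator (E (Suc t)) w \<partial>M)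
      = c * emeasure M (space M - E t)
        + (\<integral>\<^sup>+w. c * indicator (E t - E (Suc t)) w + W (Suc t) w * indicator (E (Suc t)) w \<partial>M)"
      by (simp add: nn_integral_add nn_integral_cmult_indicator distrib_left add.assoc)
    also have "\<dots> \<le> c * emeasure M (space M - E t) + (\<integral>\<^sup>+w. W (Suc t) w * indicator (E t) w \<partial>M)"
    proof (intro add_left_mono nn_integral_mono_AE)
      show "AE w in M. c * indicator (E t - E (Suc t)) w + W (Suc t) w * indicator (E (Suc t)) w
          \<le> W (Suc t) w * indicator (E t) w"
        using c[OF t] by (rule eventually_mono) (use sub[OF t] in \<open>auto split: split_indicator\<close>)
    qed
    also have "\<dots> \<le> c * emeasure M (space M - E t) + (\<integral>\<^sup>+w. W t w * indicator (E t) w \<partial>M)"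
      by (intro add_left_mono step t)
    also have "\<dots> \<le> (\<integral>\<^sup>+w. W 0 w \<partial>M)" using Suc by simp
    finally show ?case .
  qed
  from this[of n] show ?thesis
    by (metis (no_types, lifting) add_increasing2 le_iff_add order_refl order_trans zero_le)
qed

subsection \<open>Self-normalised deviations\<close>

lemma borel_measurable_cosh [measurable]: "(cosh :: real \<Rightarrow> real) \<in> borel_measurable borel"
  by (intro borel_measurable_continuous_onI continuous_intros)

lemma borel_measurable_sinh [measurable]: "(sinh :: real \<Rightarrow> real) \<in> borel_measurable borel"
  by (intro borel_measurable_continuous_onI continuous_intros)

text \<open>The moments are formed with \<open>nn_cond_exp\<close>, so their finiteness is not
  presupposed, whereas centering through \<open>real_cond_exp\<close> takes its usual meaning from
  \<open>eps_int\<close>. For \<open>m = 2\<close> the factor \<open>B ^ 0\<close> is 1 even if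
  \<open>B = 0\<close>.\<close>

locale self_normalized = prob_space M
  for M :: "'w measure" +
  fixes F :: "nat \<Rightarrow> 'w measure"
    and X :: "nat \<Rightarrow> 'w \<Rightarrow> 'h::{real_inner, complete_space, second_countable_topology}"
    and \<epsilon> \<sigma> :: "nat \<Rightarrow> 'w \<Rightarrow> real"
    and n :: nat and B \<rho> :: real
  assumes filt_sub: "\<And>t. subalgebra M (F t)"
    and filt_mono: "\<And>s t. s \<le> t \<Longrightarrow> sets (F s) \<subseteq> sets (F t)"
    and X_meas: "\<And>t. t \<in> {1..n} \<Longrightarrow> X t \<in> borel_measurable (F (t - 1))"
    and eps_meas: "\<And>t. t \<in> {1..n} \<Longrightarrow> \<epsilon> t \<in> borel_measurable (F t)"
    and eps_int: "\<And>t. t \<in> {1..n} \<Longrightarrow> integrable M (\<epsilon> t)"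
    and eps_cond0: "\<And>t. t \<in> {1..n} \<Longrightarrow> AE w in M. real_cond_exp M (F (t - 1)) (\<epsilon> t) w = 0"
    and B_nonneg: "B \<ge> 0"
    and sigma_meas: "\<And>i. i \<in> {1..n} \<Longrightarrow> \<sigma> i \<in> borel_measurable (F (i - 1))"
    and bernstein: "\<And>i m. i \<in> {1..n} \<Longrightarrow> m \<ge> 2 \<Longrightarrow>
          AE w in M. nn_cond_exp M (F (i - 1)) (\<lambda>v. ennreal (\<bar>\<epsilon> i v\<bar> ^ m)) w
                       \<le> ennreal (fact m / 2 * B ^ (m - 2) * (\<sigma> i w)\<^sup>2)"
    and \<rho>: "\<rho> > 0"
begin

abbreviation whiten :: "nat \<Rightarrow> 'w \<Rightarrow> 'h \<Rightarrow> 'h" where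
  "whiten t w \<equiv> inv_sqrt_op (reg_gram_op \<rho> X t w)"

abbreviation dev :: "nat \<Rightarrow> 'w \<Rightarrow> real" where
  "dev t w \<equiv> norm (whiten t w (mart_sum X \<epsilon> t w))"

definition qvar :: "nat \<Rightarrow> 'w \<Rightarrow> real" where
  "qvar t w = (\<Sum>i\<in>{1..t}. (\<sigma> i w)\<^sup>2 * (norm (whiten i w (X i w)))\<^sup>2)"

section \<open>Adaptedness and predictability\<close>

lemma measurable_filt_mono:
  assumes "f \<in> measurable (F s) N" "s \<le> t"
  shows "f \<in> measurable (F t) N"
  using assms filt_sub filt_mono[OF assms(2)]
  by (intro measurable_from_subalg[of "F t" "F s" f N]) (auto simp: subalgebra_def)

text \<open>The range \<open>s \<le> Suc t\<close> expresses predictability: the operator at time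
  \<open>Suc t\<close> involves \<open>X\<close> only up to index \<open>Suc t\<close>, all
  measurable with respect to \<open>F t\<close>.\<close>

lemma measurable_inner_reg_gram_inv:
  assumes "s \<le> Suc t" "s \<le> n" "u \<in> borel_measurable (F t)" "v \<in> borel_measurable (F t)"
  shows "(\<lambda>w. u w \<bullet> reg_gram_inv \<rho> X s w (v w)) \<in> borel_measurable (F t)"
proof -
  have "X i \<in> borel_measurable (F t)" if "i \<in> {1..s}" for i
    using measurable_filt_mono[OF X_meas[of i], of t] that assms by auto
  from measurable_reg_gram_inv[OF this assms(4)] show ?thesis
    using assms(3) by (intro borel_measurable_inner)
qed

lemma measurable_norm_whiten:
  assumes "s \<le> Suc t" "s \<le> n" "v \<in> borel_measurable (F t)"
  shows "(\<lambda>w. norm (whiten s w (v w))) \<in> borel_measurable (F t)"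
  unfolding norm_inv_sqrt_reg_gram[OF \<rho>]
  using measurable_inner_reg_gram_inv[OF assms(1,2,3,3)] by measurable

lemma measurable_mart_sum:
  assumes "t \<le> n"
  shows "mart_sum X \<epsilon> t \<in> borel_measurable (F t)"
proof -
  have "X i \<in> borel_measurable (F t)" "\<epsilon> i \<in> borel_measurable (F t)" if "i \<in> {1..t}" for i
    using measurable_filt_mono[OF X_meas[of i], of t] measurable_filt_mono[OF eps_meas[of i], of t]
      that assms by auto
  then show ?thesis
    unfolding mart_sum_def[abs_def] by (intro borel_measurable_sum borel_measurable_scaleR)
qed

lemma measurable_dev:
  assumes "t \<le> n"
  shows "dev t \<in> borel_measurable (F t)"
  using measurable_norm_whiten[OF _ assms measurable_mart_sum[OF assms]] by simp

lemma measurable_qvar: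
  assumes "s \<le> Suc t" "s \<le> n"
  shows "qvar s \<in> borel_measurable (F t)"
proof -
  have "\<sigma> i \<in> borel_measurable (F t)" "(\<lambda>w. norm (whiten i w (X i w))) \<in> borel_measurable (F t)"
    if "i \<in> {1..s}" for i
    using measurable_filt_mono[OF sigma_meas[of i], of t]
      measurable_norm_whiten[OF _ _ measurable_filt_mono[OF X_meas[of i], of t], of i] that assms
    by auto
  then show ?thesis
    unfolding qvar_def[abs_def] by (intro borel_measurable_sum borel_measurable_times borel_measurable_power)
qed

section \<open>The one-step supermartingale estimate\<close>

lemma mart_sum_Suc: "mart_sum X \<epsilon> (Suc t) w = mart_sum X \<epsilon> t w + \<epsilon> (Suc t) w *\<^sub>R X (Suc t) w"
  by (simp add: mart_sum_def)

lemma dev_0: "dev 0 w = 0"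
  using linear_0[OF linear_inv_sqrt_reg_gram[OF \<rho>]] by (simp add: mart_sum_def)

text \<open>Both \<open>x\<close> and \<open>u\<close> are whitened at time \<open>Suc t\<close>, so
  the coefficients of the new noise are \<open>F t\<close>-measurable; the return to time
  \<open>t\<close> is left to monotonicity. Writing \<open>x \<bullet> u\<close> through
  \<open>reg_gram_inv\<close> gives access to its measurability.\<close>

lemma cosh_dev_Suc_le:
  assumes l: "l \<ge> 0"
  shows "cosh (l * dev (Suc t) w)
    \<le> cosh (l * norm (whiten (Suc t) w (mart_sum X \<epsilon> t w)))
        * (exp (l * \<bar>\<epsilon> (Suc t) w\<bar> * norm (whiten (Suc t) w (X (Suc t) w)))
            - l * \<bar>\<epsilon> (Suc t) w\<bar> * norm (whiten (Suc t) w (X (Suc t) w)))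
      + l * (mart_sum X \<epsilon> t w \<bullet> reg_gram_inv \<rho> X (Suc t) w (X (Suc t) w))
        * (sinh (l * norm (whiten (Suc t) w (mart_sum X \<epsilon> t w))) / norm (whiten (Suc t) w (mart_sum X \<epsilon> t w)))
        * \<epsilon> (Suc t) w"
proof -
  let ?S = "whiten (Suc t) w"
  note lin = linear_inv_sqrt_reg_gram[OF \<rho>, of X "Suc t" w]
  define x where "x = ?S (mart_sum X \<epsilon> t w)"
  define u where "u = ?S (X (Suc t) w)"
  have "cosh (norm (l *\<^sub>R x + (l * \<epsilon> (Suc t) w) *\<^sub>R u))
    \<le> cosh (norm (l *\<^sub>R x)) * (exp (norm ((l * \<epsilon> (Suc t) w) *\<^sub>R u)) - norm ((l * \<epsilon> (Suc t) w) *\<^sub>R u))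
      + (l *\<^sub>R x \<bullet> (l * \<epsilon> (Suc t) w) *\<^sub>R u) * (sinh (norm (l *\<^sub>R x)) / norm (l *\<^sub>R x))"
    by (rule cosh_norm_add_le)
  moreover have "norm (l *\<^sub>R x + (l * \<epsilon> (Suc t) w) *\<^sub>R u) = l * dev (Suc t) w"
    using l by (simp add: mart_sum_Suc linear_add[OF lin] linear_scale[OF lin] x_def u_def
        flip: scaleR_scaleR scaleR_add_right)
  moreover have "x \<bullet> u = mart_sum X \<epsilon> t w \<bullet> reg_gram_inv \<rho> X (Suc t) w (X (Suc t) w)"
    unfolding x_def u_def by (rule inner_inv_sqrt_reg_gram[OF \<rho>])
  moreover have "(l *\<^sub>R x \<bullet> (l * \<epsilon> (Suc t) w) *\<^sub>R u) * (sinh (norm (l *\<^sub>R x)) / norm (l *\<^sub>R x))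
    = l * (x \<bullet> u) * (sinh (l * norm x) / norm x) * \<epsilon> (Suc t) w"
    using l by (cases "l = 0") (auto simp: field_simps)
  ultimately show ?thesis
    using l unfolding x_def[symmetric] u_def[symmetric] by (simp add: abs_mult)
qed

text \<open>Stopping at the first exit from \<open>calm r\<close> keeps the predictable factors bounded, so no integrability
  of \<open>cosh (l * dev t w)\<close> has to be known in advance.\<close>

definition calm :: "real \<Rightarrow> nat \<Rightarrow> 'w set" where
  "calm r t = {w \<in> space M. \<forall>s\<in>{..t}. dev s w < r}"

lemma sets_calm:
  assumes "t \<le> n"
  shows "calm r t \<in> sets (F t)"
proof -
  have sp: "space M = space (F t)" using filt_sub[of t] by (simp add: subalgebra_def)
  have [measurable]: "dev s \<in> borel_measurable (F t)" if "s \<in> {..t}" for s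
    using measurable_filt_mono[OF measurable_dev[of s], of t] that assms by auto
  show ?thesis unfolding calm_def sp by measurable
qed

lemma supermartingale_step:
  assumes l: "0 \<le> l" "l * B < 1" and t: "t < n"
  defines "k \<equiv> l\<^sup>2 / (2 * (1 - l * B))"
  shows "(\<integral>\<^sup>+w. ennreal (cosh (l * dev (Suc t) w) * exp (- k * qvar (Suc t) w)) * indicator (calm r t) w \<partial>M)
    \<le> (\<integral>\<^sup>+w. ennreal (cosh (l * dev t w) * exp (- k * qvar t w)) * indicator (calm r t) w \<partial>M)"
proof -
  interpret G: finite_measure_subalgebra M "F t" by unfold_locales (rule filt_sub)
  have k: "0 \<le> k" using l by (simp add: k_def)
  let ?I = "indicat_real (calm r t)" and ?e = "\<lambda>w. exp (- k * qvar (Suc t) w)"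
  define g where "g = (\<lambda>w. norm (whiten (Suc t) w (X (Suc t) w)))"
  define p where "p = (\<lambda>w. norm (whiten (Suc t) w (mart_sum X \<epsilon> t w)))"
  define q where "q = (\<lambda>w. mart_sum X \<epsilon> t w \<bullet> reg_gram_inv \<rho> X (Suc t) w (X (Suc t) w))"
  define f where "f = (\<lambda>w. ?I w * ?e w * cosh (l * p w))"
  define h where "h = (\<lambda>w. ?I w * ?e w * (l * q w * (sinh (l * p w) / p w)))"
  have [measurable]: "g \<in> borel_measurable (F t)" "p \<in> borel_measurable (F t)"
    "q \<in> borel_measurable (F t)" "qvar (Suc t) \<in> borel_measurable (F t)"
    "calm r t \<in> sets (F t)"
    unfolding g_def p_def q_def
    using t X_meas[of "Suc t"] measurable_mart_sum[of t]
    by (auto simp del: reg_gram_inv.simps intro!: measurable_norm_whiten measurable_inner_reg_gram_inv measurable_qvar sets_calm)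
  have g1: "0 \<le> g w" "g w \<le> 1" for w
    using norm_inv_sqrt_reg_gram_le_1[OF \<rho>, of X t w] by (auto simp: g_def)
  have p0: "0 \<le> p w" "p w \<le> dev t w" for w
    using norm_inv_sqrt_reg_gram_Suc_le[OF \<rho>] by (auto simp: p_def)
  have qpg: "\<bar>q w\<bar> \<le> p w * g w" for w
    using Cauchy_Schwarz_ineq2[of "whiten (Suc t) w (mart_sum X \<epsilon> t w)" "whiten (Suc t) w (X (Suc t) w)"]
    by (simp add: p_def g_def q_def inner_inv_sqrt_reg_gram[OF \<rho>])
  have qvar0: "0 \<le> qvar s w" for s w
    unfolding qvar_def by (intro sum_nonneg) simp
  have qvarS: "qvar (Suc t) w = qvar t w + (\<sigma> (Suc t) w)\<^sup>2 * (g w)\<^sup>2" for w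
    by (simp add: qvar_def g_def)
  have e1: "exp (- k * qvar s w) \<le> 1" for s w using k qvar0 by simp
  \<comment> \<open>The exponential from the Bernstein bound cancels exactly the new term of
    \<open>qvar (Suc t)\<close>.\<close>
  have feq: "f w * exp (k * ((\<sigma> (Suc t) w)\<^sup>2 * (g w)\<^sup>2)) = ?I w * exp (- k * qvar t w) * cosh (l * p w)" for w
    by (simp add: f_def qvarS exp_add[symmetric] algebra_simps)
  have pr: "cosh (l * p w) \<le> cosh (l * r)" if "w \<in> calm r t" for w
  proof -
    have "p w \<le> r" using p0(2)[of w] that by (force simp: calm_def)
    then show ?thesis using p0(1)[of w] l
      by (subst cosh_real_nonneg_le_iff) (auto intro!: mult_left_mono)
  qed
  have "(\<integral>\<^sup>+w. ennreal (?I w * ?e w * cosh (l * dev (Suc t) w)) \<partial>M)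
    \<le> (\<integral>\<^sup>+w. ennreal (f w * exp (l\<^sup>2 / (2 * (1 - l * B)) * ((\<sigma> (Suc t) w)\<^sup>2 * (g w)\<^sup>2))) \<partial>M)"
  \<comment> \<open>\<open>cosh (l * r)\<close> bounds the first predictable factor and
    \<open>l * cosh (l * r)\<close> the second; \<open>K\<close> dominates both.\<close>
  proof (rule G.nn_integral_supermartingale_step[where \<epsilon> = "\<epsilon> (Suc t)" and h = h and B = B
        and K = "(1 + l) * cosh (l * r)"])
    show "integrable M (\<epsilon> (Suc t))" using eps_int t by simp
    show "AE w in M. real_cond_exp M (F t) (\<epsilon> (Suc t)) w = 0" using eps_cond0[of "Suc t"] t by simp
    show "\<sigma> (Suc t) \<in> borel_measurable (F t)" using sigma_meas[of "Suc t"] t by simp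
    show "AE w in M. nn_cond_exp M (F t) (\<lambda>v. ennreal (\<bar>\<epsilon> (Suc t) v\<bar> ^ m)) w
        \<le> ennreal (fact m / 2 * B ^ (m - 2) * (\<sigma> (Suc t) w)\<^sup>2)" if "m \<ge> 2" for m
      using bernstein[of "Suc t" m] that t by simp
    show "?I w * ?e w * cosh (l * dev (Suc t) w)
      \<le> f w * (exp (l * \<bar>\<epsilon> (Suc t) w\<bar> * g w) - l * \<bar>\<epsilon> (Suc t) w\<bar> * g w) + h w * \<epsilon> (Suc t) w" for w
      using mult_left_mono[OF cosh_dev_Suc_le[OF l(1), of t w], of "?I w * ?e w"]
      by (simp add: f_def h_def g_def p_def q_def algebra_simps)
    show "f w * exp (l\<^sup>2 / (2 * (1 - l * B)) * ((\<sigma> (Suc t) w)\<^sup>2 * (g w)\<^sup>2)) \<le> (1 + l) * cosh (l * r)" for w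
    proof (cases "w \<in> calm r t")
      case True
      have "exp (- k * qvar t w) * cosh (l * p w) \<le> (1 + l) * cosh (l * r)"
        using order_trans[OF e1[of t w], of "1 + l"] l pr[OF True] by (intro mult_mono) auto
      then show ?thesis using True unfolding k_def[symmetric] feq by simp
    qed (use l in \<open>simp add: f_def\<close>)
    show "\<bar>h w\<bar> \<le> (1 + l) * cosh (l * r)" for w
    proof (cases "w \<in> calm r t")
      case True
      \<comment> \<open>Where \<open>p w = 0\<close> the quotient is 0 by convention; elsewhere
        \<open>\<bar>q w\<bar> \<le> p w * g w \<le> p w\<close> absorbs the denominator.\<close>
      have "\<bar>q w * (sinh (l * p w) / p w)\<bar> \<le> cosh (l * r)"
      proof (cases "p w = 0")
        case False
        then have pp: "p w > 0" using p0(1)[of w] by simp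
        have "\<bar>q w\<bar> \<le> p w" using qpg[of w] mult_left_mono[OF g1(2)[of w] p0(1)[of w]] by simp
        then have "\<bar>q w / p w\<bar> \<le> 1" using pp by simp
        then have "\<bar>q w / p w\<bar> * sinh (l * p w) \<le> 1 * cosh (l * r)"
          using pp l pr[OF True] sinh_le_cosh_real[of "l * p w"] by (intro mult_mono) auto
        then show ?thesis using pp l by (simp add: abs_mult)
      qed simp
      then have "?e w * (l * \<bar>q w * (sinh (l * p w) / p w)\<bar>) \<le> 1 * ((1 + l) * cosh (l * r))"
        using l e1[of "Suc t" w] by (intro mult_mono) auto
      then show ?thesis using True l by (simp add: h_def abs_mult mult.assoc)
    qed (use l in \<open>simp add: h_def\<close>)
  qed (use g1 l B_nonneg in \<open>auto simp: f_def h_def\<close>)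
  \<comment> \<open>Monotonicity of the operators replaces whitening at time \<open>Suc t\<close> by
    whitening at time \<open>t\<close>.\<close>
  also have "\<dots> \<le> (\<integral>\<^sup>+w. ennreal (?I w * exp (- k * qvar t w) * cosh (l * dev t w)) \<partial>M)"
    unfolding k_def[symmetric] feq
    using l p0 by (intro nn_integral_mono ennreal_leI mult_left_mono)
      (auto simp: cosh_real_nonneg_le_iff intro!: mult_left_mono)
  finally have "(\<integral>\<^sup>+w. ennreal (?I w * ?e w * cosh (l * dev (Suc t) w)) \<partial>M)
    \<le> (\<integral>\<^sup>+w. ennreal (?I w * exp (- k * qvar t w) * cosh (l * dev t w)) \<partial>M)" .
  moreover have "ennreal (?I w * a * b) = ennreal (b * a) * indicator (calm r t) w" for a b w
    by (simp add: mult.commute split: split_indicator)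
  ultimately show ?thesis by simp
qed

section \<open>Tail bounds for the maximal deviation\<close>

lemma deviation_bound:
  assumes l: "0 \<le> l" "l * B < 1" and r: "r > 0"
    and var_bound: "AE w in M. qvar n w \<le> C\<^sup>2"
  shows "prob {w \<in> space M. \<exists>t\<in>{..n}. r \<le> dev t w} \<le> 2 * exp (- l * r + l\<^sup>2 / (2 * (1 - l * B)) * C\<^sup>2)"
proof -
  define k where "k = l\<^sup>2 / (2 * (1 - l * B))"
  have k: "0 \<le> k" using l by (simp add: k_def)
  define c where "c = cosh (l * r) * exp (- k * C\<^sup>2)"
  have c: "c > 0" by (simp add: c_def)
  have sub: "sets (F t) \<subseteq> sets M" for t using filt_sub[of t] by (simp add: subalgebra_def)
  have "ennreal c * emeasure M (space M - calm r n)
    \<le> (\<integral>\<^sup>+w. ennreal (cosh (l * dev 0 w) * exp (- k * qvar 0 w)) \<partial>M)"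
  proof (rule stopped_maximal_inequality)
    show "calm r t \<in> sets M" if "t \<le> n" for t using sets_calm[OF that] sub by blast
    show "(\<lambda>w. ennreal (cosh (l * dev t w) * exp (- k * qvar t w))) \<in> borel_measurable M" if "t \<le> n" for t
    proof -
      have [measurable]: "dev t \<in> borel_measurable M" "qvar t \<in> borel_measurable M"
        using that measurable_from_subalg[OF filt_sub measurable_dev]
          measurable_from_subalg[OF filt_sub measurable_qvar[of t t]] by auto
      show ?thesis by measurable
    qed
    \<comment> \<open>As \<open>dev 0 w = 0\<close>, the assumption \<open>r > 0\<close> excludes an
      exit at time 0.\<close>
    show "calm r 0 = space M" using r by (auto simp: calm_def dev_0)
    show "calm r (Suc t) \<subseteq> calm r t" for t by (auto simp: calm_def)
    show "(\<integral>\<^sup>+w. ennreal (cosh (l * dev (Suc t) w) * exp (- k * qvar (Suc t) w)) * indicator (calm r t) w \<partial>M)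
      \<le> (\<integral>\<^sup>+w. ennreal (cosh (l * dev t w) * exp (- k * qvar t w)) * indicator (calm r t) w \<partial>M)"
      if "t < n" for t
      unfolding k_def by (rule supermartingale_step[OF l that])
    show "AE w in M. w \<in> calm r t - calm r (Suc t) \<longrightarrow>
        ennreal c \<le> ennreal (cosh (l * dev (Suc t) w) * exp (- k * qvar (Suc t) w))" if "t < n" for t
      using var_bound
    proof (rule eventually_mono)
      fix w assume w: "qvar n w \<le> C\<^sup>2"
      show "w \<in> calm r t - calm r (Suc t) \<longrightarrow>
        ennreal c \<le> ennreal (cosh (l * dev (Suc t) w) * exp (- k * qvar (Suc t) w))"
      proof
        assume "w \<in> calm r t - calm r (Suc t)"
        then have rd: "r \<le> dev (Suc t) w" by (force simp: calm_def le_Suc_eq not_less)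
        have "qvar (Suc t) w \<le> qvar n w"
          unfolding qvar_def using that by (intro sum_mono2) auto
        then have "k * qvar (Suc t) w \<le> k * C\<^sup>2" using w k by (intro mult_left_mono) auto
        moreover have "cosh (l * r) \<le> cosh (l * dev (Suc t) w)"
          using l r rd by (subst cosh_real_nonneg_le_iff) (auto intro!: mult_left_mono)
        ultimately show "ennreal c \<le> ennreal (cosh (l * dev (Suc t) w) * exp (- k * qvar (Suc t) w))"
          unfolding c_def by (intro ennreal_leI mult_mono) auto
      qed
    qed
  qed
  also have "\<dots> = 1" by (simp add: dev_0 qvar_def emeasure_space_1)
  finally have "ennreal (c * prob (space M - calm r n)) \<le> ennreal 1"
    using c by (simp add: emeasure_eq_measure ennreal_mult)
  then have "c * prob (space M - calm r n) \<le> 1" by (subst (asm) ennreal_le_iff) auto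
  then have "prob (space M - calm r n) \<le> 1 / c" using c by (simp add: field_simps)
  also have "\<dots> = exp (k * C\<^sup>2) / cosh (l * r)"
    by (simp add: c_def exp_minus field_simps)
  \<comment> \<open>The estimate \<open>cosh y \<ge> exp y / 2\<close> is the source of the factor
    2.\<close>
  also have "\<dots> \<le> exp (k * C\<^sup>2) / (exp (l * r) / 2)"
    by (intro divide_left_mono) (auto simp: cosh_field_def add_pos_pos)
  also have "\<dots> = 2 * exp (- l * r + k * C\<^sup>2)"
    by (simp add: exp_diff)
  also have "space M - calm r n = {w \<in> space M. \<exists>t\<in>{..n}. r \<le> dev t w}"
    by (force simp: calm_def not_less)
  finally show ?thesis unfolding k_def .
qed

lemma sets_dev_exceeds:
  "{w \<in> space M. \<exists>t\<in>{..n}. r \<le> dev t w} \<in> events"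
  "{w \<in> space M. \<exists>t\<in>{..n}. r < dev t w} \<in> events"
proof -
  have [measurable]: "dev t \<in> borel_measurable M" if "t \<in> {..n}" for t
    using that measurable_from_subalg[OF filt_sub measurable_dev] by auto
  show "{w \<in> space M. \<exists>t\<in>{..n}. r \<le> dev t w} \<in> events" "{w \<in> space M. \<exists>t\<in>{..n}. r < dev t w} \<in> events"
    by measurable
qed

text \<open>The witness \<open>l\<close> is the exact optimiser of the exponent in \<open>deviation_bound\<close>.\<close>

lemma deviation_bound_subgamma:
  assumes s: "s > 0" and C: "C > 0" and var_bound: "AE w in M. qvar n w \<le> C\<^sup>2"
  shows "prob {w \<in> space M. \<exists>t\<in>{..n}. B * s + C * sqrt (2 * s) \<le> dev t w} \<le> 2 * exp (- s)"
proof -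
  define z where "z = sqrt (2 * s)"
  have z: "z > 0" "s = z\<^sup>2 / 2" using s by (auto simp: z_def)
  define d where "d = C + B * z"
  have d: "d > 0" using C B_nonneg z by (simp add: d_def add_pos_nonneg)
  define l where "l = z / d"
  \<comment> \<open>The slack in \<open>l * B < 1\<close> is \<open>C / d\<close>, so positivity of
    \<open>C\<close> makes \<open>l\<close> admissible.\<close>
  have lB: "1 - l * B = C / d" using d by (simp add: l_def d_def field_simps)
  have l: "0 \<le> l" using z d by (simp add: l_def)
  have l1: "l * B < 1" using divide_pos_pos[OF C d] lB by linarith
  have r: "B * s + C * z > 0" using C z s B_nonneg by (simp add: add_nonneg_pos)
  have "- l * (B * s + C * z) + l\<^sup>2 / (2 * (1 - l * B)) * C\<^sup>2 = - s"
  proof -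
    have "l\<^sup>2 / (2 * (1 - l * B)) * C\<^sup>2 = s * C / d"
      unfolding lB using C d by (simp add: l_def z(2) field_simps power2_eq_square)
    moreover have "l * (B * s + C * z) = (B * z * s + 2 * C * s) / d"
      using d by (simp add: l_def z(2) field_simps power2_eq_square)
    moreover have "s * C / d - (B * z * s + 2 * C * s) / d = - (s * (C + B * z)) / d"
      by (simp add: diff_divide_distrib[symmetric] algebra_simps)
    ultimately show ?thesis using d by (simp add: d_def[symmetric])
  qed
  then show ?thesis
    using deviation_bound[OF l l1 r var_bound] unfolding z_def by simp
qed

text \<open>The case \<open>C = 0\<close>, where the optimiser leaves the admissible range \<open>l * B < 1\<close>, is reached
  as a limit of positive constants.\<close>

lemma deviation_bound_subgamma_strict:
  assumes s: "s > 0" and C: "C \<ge> 0" and var_bound: "AE w in M. qvar n w \<le> C\<^sup>2"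
  shows "prob {w \<in> space M. \<exists>t\<in>{..n}. B * s + C * sqrt (2 * s) < dev t w} \<le> 2 * exp (- s)"
proof -
  define C' where "C' = (\<lambda>i::nat. C + 1 / (real i + 1))"
  define A where "A = (\<lambda>i. {w \<in> space M. \<exists>t\<in>{..n}. B * s + C' i * sqrt (2 * s) \<le> dev t w})"
  have C'le: "C' i \<le> C' j" if "j \<le> i" for i j
    using that by (auto simp: C'_def intro!: divide_left_mono)
  have C'gt: "C < C' i" for i by (simp add: C'_def)
  have pA: "prob (A i) \<le> 2 * exp (- s)" for i
  proof -
    have "C\<^sup>2 \<le> (C' i)\<^sup>2" using C C'gt[of i] by (intro power_mono) auto
    then have "AE w in M. qvar n w \<le> (C' i)\<^sup>2"
      using var_bound by (auto elim: eventually_mono)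
    then show ?thesis
      unfolding A_def using C C'gt[of i] by (intro deviation_bound_subgamma s) auto
  qed
  have "incseq A"
  proof (intro monoI subsetI)
    fix i j w assume ij: "i \<le> j" and "w \<in> A i"
    moreover have "C' j * sqrt (2 * s) \<le> C' i * sqrt (2 * s)"
      using C'le[OF ij] s by (intro mult_right_mono) auto
    ultimately show "w \<in> A j" unfolding A_def by force
  qed
  then have "(\<lambda>i. prob (A i)) \<longlonglongrightarrow> prob (\<Union>i. A i)"
    by (intro finite_Lim_measure_incseq) (auto simp: A_def sets_dev_exceeds)
  then have "prob (\<Union>i. A i) \<le> 2 * exp (- s)"
    by (rule LIMSEQ_le_const2) (use pA in auto)
  \<comment> \<open>The thresholds decrease strictly to their limit, so the non-strict exceedance
    events fill out the strict one.\<close>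
  also have "(\<Union>i. A i) = {w \<in> space M. \<exists>t\<in>{..n}. B * s + C * sqrt (2 * s) < dev t w}"
  proof (intro equalityI subsetI)
    fix w assume "w \<in> (\<Union>i. A i)"
    then obtain i t where w: "w \<in> space M" "t \<in> {..n}" "B * s + C' i * sqrt (2 * s) \<le> dev t w"
      by (auto simp: A_def)
    have "C * sqrt (2 * s) < C' i * sqrt (2 * s)" using C'gt s by simp
    then have "B * s + C * sqrt (2 * s) < dev t w" using w by linarith
    then show "w \<in> {w \<in> space M. \<exists>t\<in>{..n}. B * s + C * sqrt (2 * s) < dev t w}" using w by blast
  next
    fix w assume "w \<in> {w \<in> space M. \<exists>t\<in>{..n}. B * s + C * sqrt (2 * s) < dev t w}"
    then obtain t where w: "w \<in> space M" "t \<in> {..n}" "B * s + C * sqrt (2 * s) < dev t w" by blast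
    have "(\<lambda>i. C' i) \<longlonglongrightarrow> C + 0"
      unfolding C'_def using LIMSEQ_inverse_real_of_nat
      by (intro tendsto_add tendsto_const) (simp add: inverse_eq_divide add.commute)
    then have "(\<lambda>i. B * s + C' i * sqrt (2 * s)) \<longlonglongrightarrow> B * s + C * sqrt (2 * s)"
      by (auto intro!: tendsto_intros)
    then have "\<forall>\<^sub>F i in sequentially. B * s + C' i * sqrt (2 * s) < dev t w"
      using w(3) by (rule order_tendstoD)
    then obtain i where "B * s + C' i * sqrt (2 * s) < dev t w"
      unfolding eventually_sequentially by blast
    then show "w \<in> (\<Union>i. A i)" using w by (auto simp: A_def intro!: exI[of _ i] bexI[of _ t])
  qed
  finally show ?thesis .
qed

text \<open>For positive \<open>C\<close> and \<open>r\<close> the choice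
  \<open>l = r / (C\<^sup>2 + B * r)\<close>, simpler than the exact optimiser, produces the stated
  exponent.\<close>

lemma deviation_bound_bernstein:
  assumes r: "r \<ge> 0" and C: "C \<ge> 0" and var_bound: "AE w in M. qvar n w \<le> C\<^sup>2"
  shows "prob {w \<in> space M. \<exists>t\<in>{..n}. r \<le> dev t w} \<le> 2 * exp (- (r\<^sup>2 / (2 * (C\<^sup>2 + B * r))))"
proof -
  define d where "d = C\<^sup>2 + B * r"
  show ?thesis
  proof (cases "r = 0 \<or> d = 0")
    case True
    \<comment> \<open>If \<open>d = 0\<close>, division by zero makes the exponent 0, so in both
      cases the bound is the trivial 2.\<close>
    then have "2 * exp (- (r\<^sup>2 / (2 * d))) = 2" by auto
    moreover have "prob {w \<in> space M. \<exists>t\<in>{..n}. r \<le> dev t w} \<le> 1" by (rule prob_le_1)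
    ultimately show ?thesis unfolding d_def by linarith
  next
    case False
    then have r: "r > 0" and d: "d > 0"
      using r B_nonneg by (auto simp: d_def less_le)
    show ?thesis
    proof (cases "C = 0")
      case True
      then have B: "B > 0" using d B_nonneg by (auto simp: d_def less_le)
      \<comment> \<open>For \<open>C = 0\<close> the choice \<open>r / d\<close> would be
        \<open>1 / B\<close>, which violates \<open>l * B < 1\<close>; half of it already gives the
        claimed exponent.\<close>
      have "- (1 / (2 * B)) * r = - (r\<^sup>2 / (2 * d))"
        using True B r by (simp add: d_def field_simps power2_eq_square)
      then show ?thesis
        using deviation_bound[of "1 / (2 * B)" r, OF _ _ r var_bound] B True unfolding d_def by simp
    next
      case False
      then have C: "C > 0" using C by simp
      have lB: "1 - r / d * B = C\<^sup>2 / d" using d by (simp add: d_def field_simps)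
      have "0 < C\<^sup>2 / d" using C d by simp
      then have l1: "r / d * B < 1" using lB by linarith
      have l: "0 \<le> r / d" using r d by simp
      have "- (r / d) * r + (r / d)\<^sup>2 / (2 * (1 - r / d * B)) * C\<^sup>2 = - (r\<^sup>2 / (2 * d))"
        unfolding lB using C d by (simp add: field_simps power2_eq_square)
      then show ?thesis
        using deviation_bound[OF l l1 r var_bound] unfolding d_def by simp
    qed
  qed
qed

end

theorem theorem2:
  fixes M :: "'w measure"
    and F :: "nat \<Rightarrow> 'w measure"
    and X :: "nat \<Rightarrow> 'w \<Rightarrow> 'h::{real_inner, complete_space, second_countable_topology}"
    and \<epsilon> :: "nat \<Rightarrow> 'w \<Rightarrow> real"
    and \<sigma> :: "nat \<Rightarrow> 'w \<Rightarrow> real"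
    and n :: nat and B \<rho> C\<^sub>n :: real
  assumes "prob_space M"
    and "n > 0"
    and filt_sub: "\<And>t. subalgebra M (F t)"
    and filt_mono: "\<And>s t. s \<le> t \<Longrightarrow> sets (F s) \<subseteq> sets (F t)"
    and X_meas: "\<And>t. t \<in> {1..n} \<Longrightarrow> X t \<in> borel_measurable (F (t - 1))"
    and eps_meas: "\<And>t. t \<in> {1..n} \<Longrightarrow> \<epsilon> t \<in> borel_measurable (F t)"
    and eps_int: "\<And>t. t \<in> {1..n} \<Longrightarrow> integrable M (\<epsilon> t)"
    and eps_cond0: "\<And>t. t \<in> {1..n} \<Longrightarrow>
          AE w in M. real_cond_exp M (F (t - 1)) (\<epsilon> t) w = 0"
    and B_nonneg: "B \<ge> 0"
    and sigma_meas: "\<And>i. i \<in> {1..n} \<Longrightarrow> \<sigma> i \<in> borel_measurable (F (i - 1))"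
    and bernstein: "\<And>i m. i \<in> {1..n} \<Longrightarrow> m \<ge> 2 \<Longrightarrow>
          AE w in M. nn_cond_exp M (F (i - 1)) (\<lambda>v. ennreal (\<bar>\<epsilon> i v\<bar> ^ m)) w
                       \<le> ennreal (fact m / 2 * B ^ (m - 2) * (\<sigma> i w)\<^sup>2)"
    and "\<rho> > 0"
    and "C\<^sub>n \<ge> 0"
    and var_bound: "AE w in M. (\<Sum>i\<in>{1..n}. (\<sigma> i w)\<^sup>2 *
          (norm (inv_sqrt_op (reg_gram_op \<rho> X i w) (X i w)))\<^sup>2) \<le> C\<^sub>n\<^sup>2"
  shows "(\<forall>\<delta>::real. 0 < \<delta> \<and> \<delta> < 1 \<longrightarrow>
            measure M {w \<in> space M.
               Max ((\<lambda>t. norm (inv_sqrt_op (reg_gram_op \<rho> X t w) (mart_sum X \<epsilon> t w))) ` {..n})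
                 \<le> B * ln (2 / \<delta>) + C\<^sub>n * sqrt (2 * ln (2 / \<delta>))} \<ge> 1 - \<delta>)
       \<and> (\<forall>r::real. r \<ge> 0 \<longrightarrow>
            measure M {w \<in> space M.
               Max ((\<lambda>t. norm (inv_sqrt_op (reg_gram_op \<rho> X t w) (mart_sum X \<epsilon> t w))) ` {..n}) \<ge> r}
              \<le> 2 * exp (- (r\<^sup>2 / (2 * (C\<^sub>n\<^sup>2 + B * r)))))"
proof -
  interpret prob_space M by fact
  interpret self_normalized M F X \<epsilon> \<sigma> n B \<rho>
    by (intro self_normalized.intro self_normalized_axioms.intro; fact assms)
  have qv: "AE w in M. qvar n w \<le> C\<^sub>n\<^sup>2" using var_bound unfolding qvar_def .
  show ?thesis
  proof (intro conjI allI impI)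
    fix \<delta> :: real assume \<delta>: "0 < \<delta> \<and> \<delta> < 1"
    let ?s = "ln (2 / \<delta>)"
    let ?b = "B * ?s + C\<^sub>n * sqrt (2 * ?s)"
    have s: "?s > 0" using \<delta> by (intro ln_gt_zero) (simp add: field_simps)
    \<comment> \<open>For \<open>?s = ln (2 / \<delta>)\<close> the bound
      \<open>2 * exp (- ?s)\<close> is exactly \<open>\<delta>\<close>.\<close>
    have "1 - \<delta> \<le> 1 - prob {w \<in> space M. \<exists>t\<in>{..n}. ?b < dev t w}"
      using deviation_bound_subgamma_strict[OF s \<open>C\<^sub>n \<ge> 0\<close> qv] \<delta> by (simp add: exp_minus)
    also have "\<dots> = prob (space M - {w \<in> space M. \<exists>t\<in>{..n}. ?b < dev t w})"
      by (rule prob_compl[symmetric]) (rule sets_dev_exceeds)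
    also have "space M - {w \<in> space M. \<exists>t\<in>{..n}. ?b < dev t w}
        = {w \<in> space M. Max ((\<lambda>t. dev t w) ` {..n}) \<le> ?b}"
      by (subst Max_le_iff) (force simp: not_less)+
    finally show "1 - \<delta> \<le> prob {w \<in> space M. Max ((\<lambda>t. dev t w) ` {..n}) \<le> ?b}" .
  next
    fix r :: real assume r: "r \<ge> 0"
    have "{w \<in> space M. r \<le> Max ((\<lambda>t. dev t w) ` {..n})} = {w \<in> space M. \<exists>t\<in>{..n}. r \<le> dev t w}"
      by (subst Max_ge_iff) auto
    then show "prob {w \<in> space M. r \<le> Max ((\<lambda>t. dev t w) ` {..n})}
        \<le> 2 * exp (- (r\<^sup>2 / (2 * (C\<^sub>n\<^sup>2 + B * r))))"
      using deviation_bound_bernstein[OF r \<open>C\<^sub>n \<ge> 0\<close> qv] by simp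
  qed
qed

end
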